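(* There is an algorithm running in $O(n^3)$ time that solves Problem MaxRAB, and there is an algorithm running in $O(n^3)$ time that solves Problem MinRAB. That is: given a positive integer $n$, an integer $k$ with $1\le k<n$, a $k\times n$ Latin rectangle $A$ and a $(k+1)\times n$ Latin rectangle $B$, the algorithm outputs a $(k+1)\times n$ Latin rectangle $A'$ whose first $k$ rows coincide with those of $A$ and such that $r(A',B)$ is maximum (respectively, minimum) among all $(k+1)\times n$ Latin rectangles whose first $k$ rows coincide with those of $A$.
   Context: For a positive integer $n$, let $[n]=\{1,\dots,n\}$. A $k\times n$ Latin rectangle ($k\le n$) is a $k\times n$ array $A$ with entries $A_{i,j}\in[n]$ such that no symbol occurs more than once in any row or in any column. For two $m\times n$ arrays $A'$ and $B$ with entries in $[n]$, $r(A',B)$ denotes the number of distinct ordered pairs in the set $\{(A'_{i,j},B_{i,j}) : i\in[m], j\in[n]\}$. An extension of a $k\times n$ Latin rectangle $A$ is a $(k+1)\times n$ Latin rectangle whose first $k$ rows are the rows of $A$. Problem MaxRAB (resp. MinRAB): given a $k\times n$ Latin rectangle $A$ with $k<n$ and a $(k+1)\times n$ Latin rectangle $B$, find an extension $A'$ of $A$ maximizing (resp. minimizing) $r(A',B)$. *)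

theory Defs
  imports Complex_Main "HOL-Library.Landau_Symbols"
begin

section \<open>Latin rectangles\<close>

text \<open>An \<open>m \<times> n\<close> array is a function of two indices of which only the values at
  \<open>i \<in> {1..m}\<close>, \<open>j \<in> {1..n}\<close> matter.\<close>

type_synonym array = "nat \<Rightarrow> nat \<Rightarrow> nat"

definition latin_rectangle :: "nat \<Rightarrow> nat \<Rightarrow> array \<Rightarrow> bool" where
  "latin_rectangle k n A \<longleftrightarrow> k \<le> n \<and>
     (\<forall>i\<in>{1..k}. \<forall>j\<in>{1..n}. A i j \<in> {1..n}) \<and>
     (\<forall>i\<in>{1..k}. inj_on (\<lambda>j. A i j) {1..n}) \<and>
     (\<forall>j\<in>{1..n}. inj_on (\<lambda>i. A i j) {1..k})"

definition r :: "nat \<Rightarrow> nat \<Rightarrow> array \<Rightarrow> array \<Rightarrow> nat" where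
  "r m n A B = card {(A i j, B i j) | i j. i \<in> {1..m} \<and> j \<in> {1..n}}"

definition extension :: "nat \<Rightarrow> nat \<Rightarrow> array \<Rightarrow> array \<Rightarrow> bool" where
  "extension k n A A' \<longleftrightarrow> latin_rectangle (k + 1) n A' \<and>
     (\<forall>i\<in>{1..k}. \<forall>j\<in>{1..n}. A' i j = A i j)"

definition MaxRAB :: "nat \<Rightarrow> nat \<Rightarrow> array \<Rightarrow> array \<Rightarrow> array \<Rightarrow> bool" where
  "MaxRAB k n A B A' \<longleftrightarrow> extension k n A A' \<and>
     (\<forall>C. extension k n A C \<longrightarrow> r (k + 1) n C B \<le> r (k + 1) n A' B)"

definition MinRAB :: "nat \<Rightarrow> nat \<Rightarrow> array \<Rightarrow> array \<Rightarrow> array \<Rightarrow> bool" where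
  "MinRAB k n A B A' \<longleftrightarrow> extension k n A A' \<and>
     (\<forall>C. extension k n A C \<longrightarrow> r (k + 1) n A' B \<le> r (k + 1) n C B)"


section \<open>A word RAM\<close>

text \<open>Algorithms are programs of a word RAM. The memory consists of random-access arrays of
  natural numbers, named by numbers that are fixed in the program text, so that a given program
  uses a fixed finite number of arrays; \<open>Read a e\<close> is the entry of array \<open>a\<close> at the address
  given by \<open>e\<close>. Subtraction is truncated, and a condition holds if its value is nonzero.

  Every operation takes unit time, so an expression takes time proportional to its number of
  nodes. To make this a realistic measure, words have bounded length: a program can only evaluate
  expressions all of whose subexpressions (in particular all addresses) have values below the word
  bound \<open>W\<close>, and is stuck otherwise.\<close>

datatype exp =
    Const nat
  | Read nat exp
  | Add exp exp
  | Sub exp exp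
  | Mul exp exp

datatype prog =
    Skip
  | Write nat exp exp  \<comment> \<open>array, address, new value\<close>
  | Seq prog prog
  | Cond exp prog prog
  | While exp prog

type_synonym state = "nat \<Rightarrow> nat \<Rightarrow> nat"

fun val :: "state \<Rightarrow> exp \<Rightarrow> nat" where
  "val s (Const c) = c"
| "val s (Read a e) = s a (val s e)"
| "val s (Add e f) = val s e + val s f"
| "val s (Sub e f) = val s e - val s f"
| "val s (Mul e f) = val s e * val s f"

fun cost :: "exp \<Rightarrow> nat" where
  "cost (Const c) = 1"
| "cost (Read a e) = cost e + 1"
| "cost (Add e f) = cost e + cost f + 1"
| "cost (Sub e f) = cost e + cost f + 1"
| "cost (Mul e f) = cost e + cost f + 1"

fun fits :: "nat \<Rightarrow> state \<Rightarrow> exp \<Rightarrow> bool" where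
  "fits W s (Const c) \<longleftrightarrow> c < W"
| "fits W s (Read a e) \<longleftrightarrow> fits W s e \<and> val s (Read a e) < W"
| "fits W s (Add e f) \<longleftrightarrow> fits W s e \<and> fits W s f \<and> val s (Add e f) < W"
| "fits W s (Sub e f) \<longleftrightarrow> fits W s e \<and> fits W s f \<and> val s (Sub e f) < W"
| "fits W s (Mul e f) \<longleftrightarrow> fits W s e \<and> fits W s f \<and> val s (Mul e f) < W"

text \<open>\<open>exec W p s t s'\<close>: with word bound \<open>W\<close>, program \<open>p\<close> started in state \<open>s\<close> halts after \<open>t\<close>
  time units in state \<open>s'\<close>.\<close>

inductive exec :: "nat \<Rightarrow> prog \<Rightarrow> state \<Rightarrow> nat \<Rightarrow> state \<Rightarrow> bool" for W where
  Skip: "exec W Skip s 1 s"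
| Write: "fits W s e \<Longrightarrow> fits W s f \<Longrightarrow>
    exec W (Write a e f) s (cost e + cost f + 1) (s(a := (s a)(val s e := val s f)))"
| Seq: "exec W p s t s' \<Longrightarrow> exec W q s' t' s'' \<Longrightarrow> exec W (Seq p q) s (t + t') s''"
| CondTrue: "fits W s e \<Longrightarrow> val s e \<noteq> 0 \<Longrightarrow> exec W p s t s' \<Longrightarrow>
    exec W (Cond e p q) s (cost e + 1 + t) s'"
| CondFalse: "fits W s e \<Longrightarrow> val s e = 0 \<Longrightarrow> exec W q s t s' \<Longrightarrow>
    exec W (Cond e p q) s (cost e + 1 + t) s'"
| WhileFalse: "fits W s e \<Longrightarrow> val s e = 0 \<Longrightarrow> exec W (While e p) s (cost e + 1) s"
| WhileTrue: "fits W s e \<Longrightarrow> val s e \<noteq> 0 \<Longrightarrow> exec W p s t s' \<Longrightarrow> exec W (While e p) s' t' s'' \<Longrightarrow>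
    exec W (While e p) s (cost e + 1 + t + t') s''"

inductive_cases SkipE: "exec W Skip s t s'"
inductive_cases WriteE: "exec W (Write a e f) s t s'"
inductive_cases SeqE: "exec W (Seq p q) s t s'"
inductive_cases CondE: "exec W (Cond e p q) s t s'"
inductive_cases WhileE: "exec W (While e p) s t s'"

lemma exec_deterministic:
  "exec W p s t s' \<Longrightarrow> exec W p s u s'' \<Longrightarrow> u = t \<and> s'' = s'"
proof (induction arbitrary: u s'' rule: exec.induct)
  case (Skip s) then show ?case by (auto elim: SkipE)
next
  case (Write s e f a) then show ?case by (auto elim: WriteE)
next
  case (Seq p s t s' q t' s2)
  from Seq.prems obtain u1 u2 v where "exec W p s u1 v" "exec W q v u2 s''" "u = u1 + u2"
    by (rule SeqE)
  with Seq.IH show ?case by blast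
next
  case (CondTrue s e p t s' q)
  from CondTrue.prems obtain u' where "exec W p s u' s''" "u = cost e + 1 + u'"
    by (rule CondE) (use CondTrue.hyps in simp_all)
  with CondTrue.IH show ?case by blast
next
  case (CondFalse s e q t s' p)
  from CondFalse.prems obtain u' where "exec W q s u' s''" "u = cost e + 1 + u'"
    by (rule CondE) (use CondFalse.hyps in simp_all)
  with CondFalse.IH show ?case by blast
next
  case (WhileFalse s e p) then show ?case by (auto elim: WhileE)
next
  case (WhileTrue s e p t s' t' s2)
  from WhileTrue.prems obtain u1 u2 v
    where "exec W p s u1 v" "exec W (While e p) v u2 s''" "u = cost e + 1 + u1 + u2"
    by (rule WhileE) (use WhileTrue.hyps in simp_all)
  with WhileTrue.IH show ?case by blast
qed


section \<open>Solving an extension problem\<close>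

text \<open>Row-major storage of an \<open>m \<times> n\<close> array, from address 0 on.\<close>

definition store :: "nat \<Rightarrow> nat \<Rightarrow> array \<Rightarrow> nat \<Rightarrow> nat" where
  "store m n A x = (if x < m * n then A (x div n + 1) (x mod n + 1) else 0)"

definition fetch :: "nat \<Rightarrow> (nat \<Rightarrow> nat) \<Rightarrow> array" where
  "fetch n mem i j = mem ((i - 1) * n + (j - 1))"

text \<open>Input in arrays 0 to 3, output in array 4.\<close>

definition initial :: "nat \<Rightarrow> nat \<Rightarrow> array \<Rightarrow> array \<Rightarrow> state" where
  "initial n k A B = (\<lambda>a x. 0)
     (0 := (\<lambda>x. 0)(0 := n), 1 := (\<lambda>x. 0)(0 := k), 2 := store k n A, 3 := store (k + 1) n B)"

definition final :: "nat \<Rightarrow> state \<Rightarrow> array" where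
  "final n s = fetch n (s 4)"

text \<open>A single program has to solve all instances. On instances with parameter \<open>n\<close> it may use
  words with values below \<open>n ^ d\<close> for some constant \<open>d\<close>, that is, of \<open>O(log n)\<close> bits
  (recall \<open>n \<ge> 2\<close>).\<close>

definition solves_within ::
  "prog \<Rightarrow> (nat \<Rightarrow> nat) \<Rightarrow> (nat \<Rightarrow> nat \<Rightarrow> array \<Rightarrow> array \<Rightarrow> array \<Rightarrow> bool) \<Rightarrow> bool" where
  "solves_within p T sol \<longleftrightarrow> (\<exists>d. \<forall>n k A B.
     1 \<le> k \<and> k < n \<and> latin_rectangle k n A \<and> latin_rectangle (k + 1) n B \<longrightarrow>
     (\<exists>t s. exec (n ^ d) p (initial n k A B) t s \<and> t \<le> T n \<and> sol k n A B (final n s)))"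

end

theory Submission
  imports Defs
begin

text \<open>The pairs in the new row are distinct because the row is a permutation, so an extension is
  scored by the number of columns whose new pair already occurs in the first \<open>k\<close> rows: this number
  is to be minimized for MaxRAB and maximized for MinRAB. Both are assignment problems between
  columns \<open>j\<close> and symbols \<open>x\<close> with costs in \<open>{0, 1}\<close>, where pairs \<open>(j, x)\<close> with \<open>x\<close> already in
  column \<open>j\<close> get a cost above \<open>n\<close>.

  They are solved by the primal-dual method with dual steps of size one. Potentials satisfy
  \<open>u j \<le> c j x + w x\<close>; a breadth-first search along tight edges from the first unassigned column
  either yields an augmenting path, or raising \<open>u\<close> on the reached columns and \<open>w\<close> on the reached
  symbols increases \<open>\<Sum>u - \<Sum>w\<close> by exactly one. The graph of allowed pairs is regular of degree
  \<open>n - k\<close>, and summing the dual constraints over it gives \<open>\<Sum>u - \<Sum>w \<le> n\<close>. Hence there are at most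
  \<open>2n\<close> searches, each taking time \<open>O(n\<^sup>2)\<close>. The same bound shows that the optimal assignment costs
  at most \<open>n\<close>, so that it uses no forbidden pair; Hall's theorem is not needed.\<close>


section \<open>Running time and word length\<close>

text \<open>A program all of whose loops iterate at most \<open>N\<close> times takes at most \<open>time_bound N p\<close> time
  units, a polynomial in \<open>N\<close> of degree the nesting depth of loops.\<close>

fun time_bound :: "nat \<Rightarrow> prog \<Rightarrow> nat" where
  "time_bound N Skip = 1"
| "time_bound N (Write a e f) = cost e + cost f + 1"
| "time_bound N (Seq p q) = time_bound N p + time_bound N q"
| "time_bound N (Cond e p q) = cost e + 1 + time_bound N p + time_bound N q"
| "time_bound N (While e p) = N * (cost e + 1 + time_bound N p) + (cost e + 1)"

fun loop_depth :: "prog \<Rightarrow> nat" where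
  "loop_depth Skip = 0"
| "loop_depth (Write a e f) = 0"
| "loop_depth (Seq p q) = max (loop_depth p) (loop_depth q)"
| "loop_depth (Cond e p q) = max (loop_depth p) (loop_depth q)"
| "loop_depth (While e p) = loop_depth p + 1"

fun writes :: "prog \<Rightarrow> nat set" where
  "writes Skip = {}"
| "writes (Write a e f) = {a}"
| "writes (Seq p q) = writes p \<union> writes q"
| "writes (Cond e p q) = writes p \<union> writes q"
| "writes (While e p) = writes p"

text \<open>If all memory cells are at most \<open>M\<close>, then \<open>exp_bound M e\<close> bounds the values of all
  subexpressions of \<open>e\<close>; the summands \<open>+ 1\<close> for products keep this true when a factor is \<open>0\<close>.\<close>

fun exp_bound :: "nat \<Rightarrow> exp \<Rightarrow> nat" where
  "exp_bound M (Const c) = c"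
| "exp_bound M (Read a e) = exp_bound M e + M"
| "exp_bound M (Add e f) = exp_bound M e + exp_bound M f"
| "exp_bound M (Sub e f) = exp_bound M e + exp_bound M f"
| "exp_bound M (Mul e f) = (exp_bound M e + 1) * (exp_bound M f + 1)"

fun prog_bound :: "nat \<Rightarrow> prog \<Rightarrow> nat" where
  "prog_bound M Skip = 0"
| "prog_bound M (Write a e f) = exp_bound M e + exp_bound M f"
| "prog_bound M (Seq p q) = prog_bound M p + prog_bound M q"
| "prog_bound M (Cond e p q) = exp_bound M e + prog_bound M p + prog_bound M q"
| "prog_bound M (While e p) = exp_bound M e + prog_bound M p"

text \<open>The base is \<open>N + 1\<close> so that its powers are at least \<open>1\<close> and
  grow with the exponent even for \<open>N = 0\<close>; this absorbs additive constants and the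
  smaller of two depths.\<close>

lemma time_bound_polynomial:
  "\<exists>K. \<forall>N. time_bound N p \<le> K * (N + 1) ^ loop_depth p"
proof (induction p)
  case Skip
  then show ?case by (auto intro: exI[of _ 1])
next
  case (Write a e f)
  then show ?case by (auto intro: exI[of _ "cost e + cost f + 1"])
next
  case (Seq p q)
  then obtain K L where K: "\<And>N. time_bound N p \<le> K * (N + 1) ^ loop_depth p"
    and L: "\<And>N. time_bound N q \<le> L * (N + 1) ^ loop_depth q" by auto
  have "time_bound N (Seq p q) \<le> (K + L) * (N + 1) ^ loop_depth (Seq p q)" for N
  proof -
    have "K * (N + 1) ^ loop_depth p \<le> K * (N + 1) ^ loop_depth (Seq p q)"
      by (intro mult_left_mono power_increasing) auto
    moreover have "L * (N + 1) ^ loop_depth q \<le> L * (N + 1) ^ loop_depth (Seq p q)"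
      by (intro mult_left_mono power_increasing) auto
    ultimately have "time_bound N (Seq p q) \<le>
        K * (N + 1) ^ loop_depth (Seq p q) + L * (N + 1) ^ loop_depth (Seq p q)"
      using K[of N] L[of N] unfolding time_bound.simps by linarith
    then show ?thesis by (simp add: algebra_simps)
  qed
  then show ?case by blast
next
  case (Cond e p q)
  then obtain K L where K: "\<And>N. time_bound N p \<le> K * (N + 1) ^ loop_depth p"
    and L: "\<And>N. time_bound N q \<le> L * (N + 1) ^ loop_depth q" by auto
  let ?d = "loop_depth (Cond e p q)"
  have "time_bound N (Cond e p q) \<le> (cost e + 1 + K + L) * (N + 1) ^ ?d" for N
  proof -
    have "K * (N + 1) ^ loop_depth p \<le> K * (N + 1) ^ ?d"
      by (intro mult_left_mono power_increasing) auto
    with K[of N] have p: "time_bound N p \<le> K * (N + 1) ^ ?d" by (rule order_trans)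
    have "L * (N + 1) ^ loop_depth q \<le> L * (N + 1) ^ ?d"
      by (intro mult_left_mono power_increasing) auto
    with L[of N] have q: "time_bound N q \<le> L * (N + 1) ^ ?d" by (rule order_trans)
    have "(cost e + 1) * 1 \<le> (cost e + 1) * (N + 1) ^ ?d" by (intro mult_left_mono) auto
    then have e: "cost e + 1 \<le> (cost e + 1) * (N + 1) ^ ?d" unfolding mult_1_right .
    have "time_bound N (Cond e p q) \<le>
        (cost e + 1) * (N + 1) ^ ?d + K * (N + 1) ^ ?d + L * (N + 1) ^ ?d"
      unfolding time_bound.simps by (intro add_mono e p q)
    then show ?thesis by (simp add: algebra_simps)
  qed
  then show ?case by blast
next
  case (While e p)
  then obtain K where K: "\<And>N. time_bound N p \<le> K * (N + 1) ^ loop_depth p" by auto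
  have "time_bound N (While e p) \<le> (cost e + 1 + K) * (N + 1) ^ loop_depth (While e p)" for N
  proof -
    have "(cost e + 1) * 1 \<le> (cost e + 1) * (N + 1) ^ loop_depth p"
      by (intro mult_left_mono) auto
    then have *: "cost e + 1 + time_bound N p \<le> (cost e + 1 + K) * (N + 1) ^ loop_depth p"
      using K[of N] by (simp add: algebra_simps)
    have "time_bound N (While e p) \<le> (N + 1) * (cost e + 1 + time_bound N p)"
      by (simp add: algebra_simps)
    also have "\<dots> \<le> (N + 1) * ((cost e + 1 + K) * (N + 1) ^ loop_depth p)"
      by (intro mult_left_mono *) auto
    finally show ?thesis by (simp add: algebra_simps)
  qed
  then show ?case by blast
qed

text \<open>The factor \<open>2\<close> that arises from adding two powers is absorbed by one more
  factor \<open>n \<ge> 2\<close>.\<close>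

lemma power_bound_add:
  fixes f g :: "nat \<Rightarrow> nat"
  assumes "\<exists>d. \<forall>n\<ge>2. f n < n ^ d" "\<exists>d. \<forall>n\<ge>2. g n < n ^ d"
  shows "\<exists>d. \<forall>n\<ge>2. f n + g n < n ^ d"
proof -
  from assms obtain d d' where d: "\<forall>n\<ge>2. f n < n ^ d" and d': "\<forall>n\<ge>2. g n < n ^ d'"
    by blast
  have "f n + g n < n ^ (d + d' + 1)" if n: "n \<ge> 2" for n
  proof -
    have "n ^ d \<le> n ^ (d + d')" "n ^ d' \<le> n ^ (d + d')"
      using n by (auto intro!: power_increasing)
    moreover have "2 * n ^ (d + d') \<le> n ^ (d + d' + 1)" using n by simp
    moreover have "f n < n ^ d" "g n < n ^ d'" using d d' n by auto
    ultimately show ?thesis by linarith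
  qed
  then show ?thesis by blast
qed

lemma power_bound_Suc_mult:
  fixes f g :: "nat \<Rightarrow> nat"
  assumes "\<exists>d. \<forall>n\<ge>2. f n < n ^ d" "\<exists>d. \<forall>n\<ge>2. g n < n ^ d"
  shows "\<exists>d. \<forall>n\<ge>2. (f n + 1) * (g n + 1) < n ^ d"
proof -
  from assms obtain d d' where d: "\<forall>n\<ge>2. f n < n ^ d" and d': "\<forall>n\<ge>2. g n < n ^ d'"
    by blast
  have "(f n + 1) * (g n + 1) < n ^ (d + d' + 1)" if n: "n \<ge> 2" for n
  proof -
    have "f n + 1 \<le> n ^ d" "g n + 1 \<le> n ^ d'" using d d' n by (simp_all add: Suc_le_eq)
    then have "(f n + 1) * (g n + 1) \<le> n ^ d * n ^ d'" by (rule mult_le_mono)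
    also have "\<dots> < n ^ (d + d' + 1)" using n by (simp add: power_add)
    finally show ?thesis .
  qed
  then show ?thesis by blast
qed

text \<open>Under the memory bound \<open>n + 2\<close>, which the programs will be shown to keep,
  evaluation only meets words polynomial in \<open>n\<close>.\<close>

lemma exp_bound_polynomial: "\<exists>d. \<forall>n\<ge>2. exp_bound (n + 2) e < n ^ d"
proof (induction e)
  case (Const c)
  have "c < n ^ c" if "n \<ge> 2" for n :: nat
    using that power_gt_expt[of n c] by simp
  then show ?case by auto
next
  case (Read a e)
  have "n + 2 < n ^ 3" if "n \<ge> 2" for n :: nat
  proof -
    have "n * 4 \<le> n * (n * n)" using mult_le_mono[OF that that] by simp
    moreover have "n ^ 3 = n * (n * n)" by (simp add: power3_eq_cube)
    ultimately show ?thesis using that by linarith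
  qed
  then have "\<exists>d. \<forall>n\<ge>2. n + 2 < (n::nat) ^ d" by blast
  with Read show ?case unfolding exp_bound.simps by (rule power_bound_add)
next
  case (Add e f)
  then show ?case unfolding exp_bound.simps by (rule power_bound_add)
next
  case (Sub e f)
  then show ?case unfolding exp_bound.simps by (rule power_bound_add)
next
  case (Mul e f)
  then show ?case unfolding exp_bound.simps by (rule power_bound_Suc_mult)
qed

lemma prog_bound_polynomial: "\<exists>d. \<forall>n\<ge>2. prog_bound (n + 2) p < n ^ d"
proof (induction p)
  case Skip
  then show ?case by (auto intro: exI[of _ 1])
qed (simp_all only: prog_bound.simps, (intro power_bound_add exp_bound_polynomial; assumption)+)

section \<open>Correctness rules with time and memory bounds\<close>

definition bounded_by :: "nat \<Rightarrow> state \<Rightarrow> bool" where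
  "bounded_by M s \<longleftrightarrow> (\<forall>a x. s a x \<le> M)"

lemma exp_bound_correct:
  assumes "bounded_by M s"
  shows "val s e \<le> exp_bound M e" and "exp_bound M e < W \<Longrightarrow> fits W s e"
proof -
  show le: "val s e \<le> exp_bound M e" for e
  proof (induction e)
    case (Read a e)
    then show ?case using assms by (simp add: bounded_by_def trans_le_add2)
  next
    case (Mul e f)
    then show ?case using mult_le_mono[OF Mul] by simp
  qed auto
  show "exp_bound M e < W \<Longrightarrow> fits W s e"
  proof (induction e)
    case (Read a e)
    have "s a (val s e) \<le> M" using assms by (simp add: bounded_by_def)
    then show ?case using Read by simp
  next
    case (Add e f)
    then show ?case using le[of e] le[of f] by simp
  next
    case (Sub e f)
    then show ?case using le[of e] by simp
  next
    case (Mul e f)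
    moreover have "val s e * val s f \<le> exp_bound M (Mul e f)" using le[of "Mul e f"] by simp
    ultimately show ?case by simp
  qed auto
qed

lemma exec_frame: "exec W p s t s' \<Longrightarrow> a \<notin> writes p \<Longrightarrow> s' a = s a"
  by (induction rule: exec.induct) auto

text \<open>\<open>W\<close> bounds the words, \<open>M\<close> the memory cells, and \<open>N\<close> the number of iterations of each loop.\<close>

definition runs :: "nat \<Rightarrow> nat \<Rightarrow> nat \<Rightarrow> prog \<Rightarrow> state \<Rightarrow> (state \<Rightarrow> bool) \<Rightarrow> bool" where
  "runs W M N p s Q \<longleftrightarrow> (prog_bound M p < W \<longrightarrow> bounded_by M s \<longrightarrow>
     (\<exists>t s'. exec W p s t s' \<and> t \<le> time_bound N p \<and> bounded_by M s' \<and> Q s'))"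

text \<open>Besides weakening the postcondition this supplies the frame: specifications of
  \<open>p\<close> can stay silent about arrays outside \<open>writes p\<close>.\<close>

lemma runs_mono:
  assumes "runs W M N p s Q"
    and "\<And>s'. (\<And>a. a \<notin> writes p \<Longrightarrow> s' a = s a) \<Longrightarrow> Q s' \<Longrightarrow> R s'"
  shows "runs W M N p s R"
  unfolding runs_def
proof (intro impI)
  assume "prog_bound M p < W" "bounded_by M s"
  with assms(1) obtain t s' where "exec W p s t s'" "t \<le> time_bound N p" "bounded_by M s'" "Q s'"
    unfolding runs_def by auto
  then show "\<exists>t s'. exec W p s t s' \<and> t \<le> time_bound N p \<and> bounded_by M s' \<and> R s'"
    using assms(2)[of s'] exec_frame by blast
qed

lemma runs_Skip: "Q s \<Longrightarrow> runs W M N Skip s Q"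
  unfolding runs_def using exec.Skip[of W s] by auto

text \<open>The only primitive rule that stores a value, so the memory bound is checked here; that
  the address fits into a word follows from the bound on \<open>prog_bound\<close>.\<close>

lemma runs_Write:
  assumes "val s f \<le> M" "Q (s(a := (s a)(val s e := val s f)))"
  shows "runs W M N (Write a e f) s Q"
  unfolding runs_def
proof (intro impI exI conjI)
  assume *: "prog_bound M (Write a e f) < W" "bounded_by M s"
  show "exec W (Write a e f) s (cost e + cost f + 1) (s(a := (s a)(val s e := val s f)))"
    using * by (intro exec.Write exp_bound_correct) auto
  show "bounded_by M (s(a := (s a)(val s e := val s f)))"
    using * assms by (simp add: bounded_by_def)
qed (use assms in auto)

lemma runs_Seq:
  assumes "runs W M N p s (\<lambda>s'. runs W M N q s' Q)"
  shows "runs W M N (Seq p q) s Q"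
  unfolding runs_def
proof (intro impI)
  assume *: "prog_bound M (Seq p q) < W" "bounded_by M s"
  then obtain t s' where 1: "exec W p s t s'" "t \<le> time_bound N p" "bounded_by M s'"
    "runs W M N q s' Q" using assms unfolding runs_def[of _ _ _ p] by auto
  with * obtain t' s'' where 2: "exec W q s' t' s''" "t' \<le> time_bound N q" "bounded_by M s''"
    "Q s''" unfolding runs_def by auto
  show "\<exists>t s'. exec W (Seq p q) s t s' \<and> t \<le> time_bound N (Seq p q) \<and> bounded_by M s' \<and> Q s'"
    using exec.Seq[OF 1(1) 2(1)] 1 2
    by (intro exI[of _ "t + t'"] exI[of _ s'']) auto
qed

lemma runs_Cond:
  assumes "val s e \<noteq> 0 \<Longrightarrow> runs W M N p s Q" "val s e = 0 \<Longrightarrow> runs W M N q s Q"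
  shows "runs W M N (Cond e p q) s Q"
  unfolding runs_def
proof (intro impI)
  assume *: "prog_bound M (Cond e p q) < W" "bounded_by M s"
  then have fits: "fits W s e" by (intro exp_bound_correct) auto
  show "\<exists>t s'. exec W (Cond e p q) s t s' \<and> t \<le> time_bound N (Cond e p q) \<and> bounded_by M s' \<and> Q s'"
  proof (cases "val s e = 0")
    case True
    then obtain t s' where 1: "exec W q s t s'" "t \<le> time_bound N q" "bounded_by M s'" "Q s'"
      using assms * unfolding runs_def by auto
    show ?thesis using exec.CondFalse[OF fits True 1(1)] 1
      by (intro exI[of _ "cost e + 1 + t"] exI[of _ s']) auto
  next
    case False
    then obtain t s' where 1: "exec W p s t s'" "t \<le> time_bound N p" "bounded_by M s'" "Q s'"
      using assms * unfolding runs_def by auto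
    show ?thesis using exec.CondTrue[OF fits False 1(1)] 1
      by (intro exI[of _ "cost e + 1 + t"] exI[of _ s']) auto
  qed
qed

text \<open>The initial value of the variant \<open>\<mu>\<close> bounds the number of iterations.
  The frame refers to the state \<open>s\<close> on loop entry, so an invariant need only describe
  arrays that the body changes.\<close>

lemma runs_While:
  assumes I: "I s" and N: "\<mu> s \<le> N"
    and step: "\<And>s'. I s' \<Longrightarrow> val s' e \<noteq> 0 \<Longrightarrow> (\<And>a. a \<notin> writes p \<Longrightarrow> s' a = s a) \<Longrightarrow>
      runs W M N p s' (\<lambda>s''. I s'' \<and> \<mu> s'' < (\<mu> s' :: nat))"
    and exit: "\<And>s'. I s' \<Longrightarrow> val s' e = 0 \<Longrightarrow> (\<And>a. a \<notin> writes p \<Longrightarrow> s' a = s a) \<Longrightarrow> Q s'"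
  shows "runs W M N (While e p) s Q"
  unfolding runs_def
proof (intro impI)
  assume *: "prog_bound M (While e p) < W" "bounded_by M s"
  \<comment> \<open>The time is bounded by the variant of the current state, so that each decrease
    pays for one iteration.\<close>
  have "\<exists>t s''. exec W (While e p) s' t s'' \<and> t \<le> \<mu> s' * (cost e + 1 + time_bound N p) + (cost e + 1)
      \<and> bounded_by M s'' \<and> Q s''"
    if "I s'" "bounded_by M s'" "\<And>a. a \<notin> writes p \<Longrightarrow> s' a = s a" for s'
    using that
  proof (induction "\<mu> s'" arbitrary: s' rule: less_induct)
    case less
    have fits: "fits W s' e" using * less.prems by (intro exp_bound_correct) auto
    show ?case
    proof (cases "val s' e = 0")
      case True
      then show ?thesis using exec.WhileFalse[OF fits True] less.prems exit
        by (intro exI[of _ "cost e + 1"] exI[of _ s']) auto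
    next
      case False
      then obtain t v where 1: "exec W p s' t v" "t \<le> time_bound N p" "bounded_by M v"
        "I v" "\<mu> v < \<mu> s'"
        using step[OF less.prems(1) False less.prems(3)] less.prems(2) * unfolding runs_def by auto
      have "\<And>a. a \<notin> writes p \<Longrightarrow> v a = s a" using exec_frame[OF 1(1)] less.prems(3) by simp
      from less.hyps[OF 1(5) 1(4) 1(3) this] obtain t' v' where 2: "exec W (While e p) v t' v'"
        "t' \<le> \<mu> v * (cost e + 1 + time_bound N p) + (cost e + 1)" "bounded_by M v'" "Q v'" by auto
      have "(\<mu> v + 1) * (cost e + 1 + time_bound N p) \<le> \<mu> s' * (cost e + 1 + time_bound N p)"
        using 1(5) by (intro mult_right_mono) auto
      then have "cost e + 1 + t + t' \<le> \<mu> s' * (cost e + 1 + time_bound N p) + (cost e + 1)"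
        using 1(2) 2(2) by (simp add: algebra_simps)
      then show ?thesis using exec.WhileTrue[OF fits False 1(1) 2(1)] 2 by blast
    qed
  qed
  from this[OF I *(2)] obtain t s'' where 1: "exec W (While e p) s t s''"
    "t \<le> \<mu> s * (cost e + 1 + time_bound N p) + (cost e + 1)" "bounded_by M s''" "Q s''" by auto
  have "\<mu> s * (cost e + 1 + time_bound N p) \<le> N * (cost e + 1 + time_bound N p)"
    using N by (rule mult_right_mono) simp
  then show "\<exists>t s'. exec W (While e p) s t s' \<and> t \<le> time_bound N (While e p) \<and> bounded_by M s' \<and> Q s'"
    using 1 by (intro exI[of _ t] exI[of _ s'']) auto
qed

text \<open>Scalar variables live at address \<open>0\<close> of their own arrays.\<close>

abbreviation Var :: "nat \<Rightarrow> exp" where "Var a \<equiv> Read a (Const 0)"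

definition Assign :: "nat \<Rightarrow> exp \<Rightarrow> prog" where
  "Assign a e = Write a (Const 0) e"

text \<open>As subtraction is truncated, the condition is nonzero exactly while the counter is at
  most the limit; the counter ends one above it.\<close>

definition For :: "nat \<Rightarrow> nat \<Rightarrow> prog \<Rightarrow> prog" where
  "For v a p = Seq (Assign v (Const 1))
     (While (Sub (Add (Var a) (Const 1)) (Var v)) (Seq p (Assign v (Add (Var v) (Const 1)))))"

lemma writes_Assign [simp]: "writes (Assign a e) = {a}"
  by (simp add: Assign_def)

lemma writes_For [simp]: "writes (For v a p) = insert v (writes p)"
  by (auto simp: For_def)

lemma runs_Assign:
  assumes "val s f \<le> M" "Q (s(a := (s a)(0 := val s f)))"
  shows "runs W M N (Assign a f) s Q"
  using assms runs_Write[of s f M Q a "Const 0"] by (simp add: Assign_def)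

text \<open>\<open>I x\<close> describes the state at the start of iteration \<open>x\<close>, with
  the counter already set to \<open>x\<close>. The strict \<open>m < M\<close> leaves room for the
  final counter value \<open>m + 1\<close>.\<close>

lemma runs_For:
  assumes m: "s a 0 = m" "m \<le> N" "m < M" and a: "a \<noteq> v" "a \<notin> writes p" "v \<notin> writes p"
    and init: "I 1 (s(v := (s v)(0 := 1)))"
    and step: "\<And>x s'. 1 \<le> x \<Longrightarrow> x \<le> m \<Longrightarrow> I x s' \<Longrightarrow> s' v 0 = x \<Longrightarrow>
      (\<And>b. b \<notin> insert v (writes p) \<Longrightarrow> s' b = s b) \<Longrightarrow>
      runs W M N p s' (\<lambda>s''. I (Suc x) (s''(v := (s'' v)(0 := Suc x))))"
    and exit: "\<And>s'. I (Suc m) s' \<Longrightarrow> (\<And>b. b \<notin> insert v (writes p) \<Longrightarrow> s' b = s b) \<Longrightarrow> Q s'"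
  shows "runs W M N (For v a p) s Q"
  unfolding For_def
proof (intro runs_Seq runs_Assign)
  let ?s = "s(v := (s v)(0 := 1))"
  show "val s (Const 1) \<le> M" using m by simp
  have "runs W M N (While (Sub (Add (Var a) (Const 1)) (Var v)) (Seq p (Assign v (Add (Var v) (Const 1))))) ?s Q"
  proof (rule runs_While[where \<mu> = "\<lambda>s'. m + 1 - s' v 0"
        and I = "\<lambda>s'. 1 \<le> s' v 0 \<and> s' v 0 \<le> m + 1 \<and> I (s' v 0) s'"], goal_cases)
    case 1
    then show ?case using init by simp
  next
    case 2
    then show ?case using m by simp
  next
    case (3 s')
    have fr: "s' b = s b" if "b \<notin> insert v (writes p)" for b
      using 3(3)[of b] that by auto
    have sa: "s' a 0 = m" using fr[of a] a m by simp
    have "s' v 0 \<le> m" "1 \<le> s' v 0" using 3(1,2) sa by auto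
    with step[of "s' v 0" s'] 3(1) fr
    have "runs W M N p s' (\<lambda>s''. I (Suc (s' v 0)) (s''(v := (s'' v)(0 := Suc (s' v 0)))))" by blast
    then have "runs W M N p s' (\<lambda>s''. s'' v 0 = s' v 0 \<and> I (Suc (s' v 0)) (s''(v := (s'' v)(0 := Suc (s' v 0)))))"
      by (rule runs_mono) (use a in auto)
    then show ?case
      by (intro runs_Seq) (rule runs_mono, assumption, rule runs_Assign, use \<open>s' v 0 \<le> m\<close> m in auto)
  next
    case (4 s')
    have fr: "s' b = s b" if "b \<notin> insert v (writes p)" for b
      using 4(3)[of b] that by auto
    have sa: "s' a 0 = m" using fr[of a] a m by simp
    then have "s' v 0 = Suc m" using 4 by simp
    then show ?case using exit 4 fr by auto
  qed
  then show "runs W M N (While (Sub (Add (Var a) (Const 1)) (Var v)) (Seq p (Assign v (Add (Var v) (Const 1)))))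
    (s(v := (s v)(0 := val s (Const 1)))) Q" by simp
qed


section \<open>The primal-dual method\<close>

text \<open>The dual constraints of the assignment problem with symbol potentials negated, which
  keeps both potentials natural numbers; the dual objective is
  \<open>\<Sum>u - \<Sum>w\<close>.\<close>

definition feasible :: "nat \<Rightarrow> (nat \<Rightarrow> nat \<Rightarrow> nat) \<Rightarrow> (nat \<Rightarrow> nat) \<Rightarrow> (nat \<Rightarrow> nat) \<Rightarrow> bool" where
  "feasible n c u w \<longleftrightarrow> (\<forall>j\<in>{1..n}. \<forall>x\<in>{1..n}. u j \<le> c j x + w x)"

text \<open>Columns \<open>1, \<dots>, m - 1\<close> are matched: \<open>f\<close> maps columns to symbols, \<open>g\<close> symbols to columns,
  and \<open>0\<close> stands for unmatched.\<close>

definition partial_matching ::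
  "nat \<Rightarrow> (nat \<Rightarrow> nat \<Rightarrow> nat) \<Rightarrow> (nat \<Rightarrow> nat) \<Rightarrow> (nat \<Rightarrow> nat) \<Rightarrow> nat \<Rightarrow> (nat \<Rightarrow> nat) \<Rightarrow> (nat \<Rightarrow> nat) \<Rightarrow> bool"
  where "partial_matching n c u w m f g \<longleftrightarrow>
     (\<forall>j\<in>{1..<m}. f j \<in> {1..n} \<and> g (f j) = j \<and> u j = c j (f j) + w (f j)) \<and>
     (\<forall>j. j \<notin> {1..<m} \<longrightarrow> f j = 0) \<and>
     (\<forall>x\<in>{1..n}. g x \<noteq> 0 \<longrightarrow> f (g x) = x)"

text \<open>Each dual step raises \<open>\<Sum>u - \<Sum>w\<close> by one and each potential by at most one, so the potentials
  stay small enough for the memory bound.\<close>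

definition dual_growth :: "nat \<Rightarrow> (nat \<Rightarrow> nat) \<Rightarrow> (nat \<Rightarrow> nat) \<Rightarrow> bool" where
  "dual_growth n u w \<longleftrightarrow> sum w {1..n} \<le> sum u {1..n} \<and> (\<forall>j\<in>{1..n}.
     u j + sum w {1..n} \<le> sum u {1..n} \<and> w j + sum w {1..n} \<le> sum u {1..n})"

text \<open>Breadth-first search from column \<open>m\<close>. The queue of columns is \<open>q 0, \<dots>, q (t - 1)\<close>, of which
  the first \<open>h\<close> have been taken out; of the last of these only the symbols below \<open>x0\<close> have been
  scanned. \<open>vis x\<close> is \<open>0\<close> for unvisited symbols, and \<open>i + 1\<close> if \<open>x\<close> was reached from \<open>q i\<close>;
  \<open>z\<close> is a visited unmatched symbol, or \<open>0\<close> if there is none.\<close>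

definition search ::
  "nat \<Rightarrow> (nat \<Rightarrow> nat \<Rightarrow> nat) \<Rightarrow> (nat \<Rightarrow> nat) \<Rightarrow> (nat \<Rightarrow> nat) \<Rightarrow> nat \<Rightarrow> (nat \<Rightarrow> nat) \<Rightarrow> (nat \<Rightarrow> nat) \<Rightarrow>
   (nat \<Rightarrow> nat) \<Rightarrow> (nat \<Rightarrow> nat) \<Rightarrow> nat \<Rightarrow> nat \<Rightarrow> nat \<Rightarrow> nat \<Rightarrow> bool"
  where "search n c u w m f g vis q h t z x0 \<longleftrightarrow>
     h \<le> t \<and> 1 \<le> t \<and> q 0 = m \<and> inj_on q {..<t} \<and> vis 0 = 0 \<and>
     (\<forall>i. 1 \<le> i \<longrightarrow> i < t \<longrightarrow> q i \<in> {1..<m} \<and> vis (f (q i)) \<noteq> 0 \<and> vis (f (q i)) \<le> i) \<and>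
     (\<forall>x\<in>{1..n}. vis x \<noteq> 0 \<longrightarrow> vis x \<le> h \<and>
        u (q (vis x - 1)) = c (q (vis x - 1)) x + w x \<and> (g x = 0 \<longrightarrow> z \<noteq> 0) \<and>
        (g x \<noteq> 0 \<longrightarrow> (\<exists>i. 1 \<le> i \<and> i < t \<and> q i = g x))) \<and>
     (z \<noteq> 0 \<longrightarrow> z \<in> {1..n} \<and> vis z \<noteq> 0 \<and> g z = 0) \<and>
     (\<forall>i<h. \<forall>x\<in>{1..n}. Suc i < h \<or> x < x0 \<longrightarrow> u (q i) = c (q i) x + w x \<longrightarrow> vis x \<noteq> 0)"

lemma searchD:
  assumes "search n c u w m f g vis q h t z x0"
  shows "h \<le> t" "1 \<le> t" "q 0 = m" "inj_on q {..<t}" "vis 0 = 0"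
    and "\<And>i. 1 \<le> i \<Longrightarrow> i < t \<Longrightarrow> q i \<in> {1..<m}"
    and "\<And>i. 1 \<le> i \<Longrightarrow> i < t \<Longrightarrow> vis (f (q i)) \<noteq> 0"
    and "\<And>i. 1 \<le> i \<Longrightarrow> i < t \<Longrightarrow> vis (f (q i)) \<le> i"
    and "\<And>x. x \<in> {1..n} \<Longrightarrow> vis x \<noteq> 0 \<Longrightarrow> vis x \<le> h"
    and "\<And>x. x \<in> {1..n} \<Longrightarrow> vis x \<noteq> 0 \<Longrightarrow>
      u (q (vis x - 1)) = c (q (vis x - 1)) x + w x"
    and "\<And>x. x \<in> {1..n} \<Longrightarrow> vis x \<noteq> 0 \<Longrightarrow> g x = 0 \<Longrightarrow> z \<noteq> 0"
    and "\<And>x. x \<in> {1..n} \<Longrightarrow> vis x \<noteq> 0 \<Longrightarrow> g x \<noteq> 0 \<Longrightarrow> \<exists>i. 1 \<le> i \<and> i < t \<and> q i = g x"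
    and "z \<noteq> 0 \<Longrightarrow> z \<in> {1..n}" "z \<noteq> 0 \<Longrightarrow> vis z \<noteq> 0" "z \<noteq> 0 \<Longrightarrow> g z = 0"
    and "\<And>i x. i < h \<Longrightarrow> x \<in> {1..n} \<Longrightarrow> Suc i < h \<or> x < x0 \<Longrightarrow>
      u (q i) = c (q i) x + w x \<Longrightarrow> vis x \<noteq> 0"
proof -
  show "vis x \<noteq> 0" if "i < h" "x \<in> {1..n}" "Suc i < h \<or> x < x0" "u (q i) = c (q i) x + w x" for i x
    using assms that unfolding search_def by blast
qed (use assms in \<open>simp_all add: search_def\<close>)

lemma partial_matchingD:
  assumes "partial_matching n c u w m f g"
  shows "\<And>j. j \<in> {1..<m} \<Longrightarrow> f j \<in> {1..n}"
    and "\<And>j. j \<in> {1..<m} \<Longrightarrow> g (f j) = j"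
    and "\<And>j. j \<in> {1..<m} \<Longrightarrow> u j = c j (f j) + w (f j)"
    and "\<And>j. j \<notin> {1..<m} \<Longrightarrow> f j = 0"
    and "\<And>x. x \<in> {1..n} \<Longrightarrow> g x \<noteq> 0 \<Longrightarrow> f (g x) = x"
  using assms unfolding partial_matching_def by simp_all

section \<open>Steps of the breadth-first search\<close>

lemma search_init:
  assumes "\<forall>x\<in>{1..n}. vis x = 0" "vis 0 = 0" "q 0 = m"
  shows "search n c u w m f g vis q 0 1 0 (Suc n)"
  using assms unfolding search_def by (auto simp: inj_on_def)

text \<open>\<open>x0 = Suc n\<close> says that the old head is completely scanned. For the new head
  the range \<open>x < 1\<close> is empty, so nothing is claimed yet.\<close>

lemma search_next:
  assumes "search n c u w m f g vis q h t z (Suc n)" "h < t"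
  shows "search n c u w m f g vis q (Suc h) t z 1"
  using assms unfolding search_def by (auto simp: le_Suc_eq)

text \<open>Queue entries are distinct columns up to \<open>m\<close>, so the pigeonhole principle
  bounds the queue. This later limits the number of scans and the stored values.\<close>

lemma search_queue:
  assumes "search n c u w m f g vis q h t z x" "1 \<le> m"
  shows "t \<le> m" and "i < t \<Longrightarrow> q i \<in> {1..m}"
proof -
  show *: "q i \<in> {1..m}" if "i < t" for i
  proof (cases "i = 0")
    case False
    then have "q i \<in> {1..<m}" using assms(1) that unfolding search_def by simp
    then show ?thesis by auto
  qed (use assms in \<open>auto simp: search_def\<close>)
  then have "card {..<t} \<le> card {1..m}"
    using assms(1) by (intro card_inj_on_le[of q]) (auto simp: search_def)
  then show "t \<le> m" by simp
qed

text \<open>Only the completeness clause for the current column \<open>q (h - 1)\<close> and the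
  symbol \<open>x\<close> is new, and it holds by the second assumption.\<close>

lemma search_skip:
  assumes "search n c u w m f g vis q h t z x"
    and "vis x \<noteq> 0 \<or> u (q (h - 1)) \<noteq> c (q (h - 1)) x + w x"
  shows "search n c u w m f g vis q h t z (Suc x)"
proof -
  have "vis y \<noteq> 0" if "i < h" "y \<in> {1..n}" "Suc i < h \<or> y < Suc x" "u (q i) = c (q i) y + w y" for i y
  proof (cases "Suc i < h \<or> y < x")
    case True
    then show ?thesis using searchD(16)[OF assms(1)] that by blast
  next
    case False
    then have "i = h - 1" "y = x" using that by auto
    then show ?thesis using assms that by blast
  qed
  then show ?thesis using assms(1) unfolding search_def by simp
qed

text \<open>The column \<open>g x\<close> is not yet queued: the root \<open>m\<close> is unmatched,
  and every other queued column has a visited partner, whereas \<open>x\<close> is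
  unvisited.\<close>

lemma search_push:
  assumes S: "search n c u w m f g vis q h t z x" and m: "partial_matching n c u w m f g"
    and x: "x \<in> {1..n}" and h: "1 \<le> h" and new: "vis x = 0"
    and tight: "u (q (h - 1)) = c (q (h - 1)) x + w x" and g: "g x \<noteq> 0"
  shows "search n c u w m f g (vis(x := h)) (q(t := g x)) h (Suc t) z (Suc x)"
proof -
  have gx: "g x \<in> {1..<m}" "f (g x) = x"
  proof -
    show *: "f (g x) = x" using partial_matchingD(5)[OF m x g] .
    show "g x \<in> {1..<m}" using partial_matchingD(4)[OF m, of "g x"] * x by fastforce
  qed
  note Q = searchD(6-8)[OF S]
  have fresh: "q i \<noteq> g x" if "i < t" for i
  proof (cases "i = 0")
    case True
    then show ?thesis using searchD(3)[OF S] gx by auto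
  next
    case False
    then show ?thesis using Q(2)[of i] that gx new by auto
  qed
  note ht = searchD(1-5)[OF S]
  have inj: "inj_on (q(t := g x)) {..<Suc t}"
    using ht(4) fresh by (fastforce simp: inj_on_def less_Suc_eq)
  have V: "vis y \<le> h \<and> u (q (vis y - 1)) = c (q (vis y - 1)) y + w y \<and> (g y = 0 \<longrightarrow> z \<noteq> 0) \<and>
        (g y \<noteq> 0 \<longrightarrow> (\<exists>i. 1 \<le> i \<and> i < t \<and> q i = g y))" if "y \<in> {1..n}" "vis y \<noteq> 0" for y
    using searchD(9-12)[OF S] that by simp
  show ?thesis
    unfolding search_def
  proof (intro conjI ballI allI impI inj)
    fix i assume i: "1 \<le> i" "i < Suc t"
    show "(q(t := g x)) i \<in> {1..<m}"
      using i gx Q[of i] by (auto simp: less_Suc_eq)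
    show "(vis(x := h)) (f ((q(t := g x)) i)) \<noteq> 0"
      using i gx Q[of i] h by (auto simp: less_Suc_eq)
    have "f (q i) \<noteq> x" if "i < t" using Q(2)[of i] that i new by auto
    then show "(vis(x := h)) (f ((q(t := g x)) i)) \<le> i"
      using i gx Q[of i] ht by (auto simp: less_Suc_eq)
  next
    fix y assume y: "y \<in> {1..n}" "(vis(x := h)) y \<noteq> 0"
    show "(vis(x := h)) y \<le> h" using y V by auto
    \<comment> \<open>Predecessors sit at positions below \<open>t\<close>, so appending at
      \<open>t\<close> does not disturb them.\<close>
    have "vis y - 1 < t" if "y \<noteq> x" using V[of y] y ht that by auto
    moreover have "h - 1 < t" using ht h by simp
    ultimately show "u ((q(t := g x)) ((vis(x := h)) y - 1)) = c ((q(t := g x)) ((vis(x := h)) y - 1)) y + w y"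
      using V[of y] y tight by auto
    show "z \<noteq> 0" if "g y = 0" using V[of y] y g that by (cases "y = x") auto
    show "\<exists>i. 1 \<le> i \<and> i < Suc t \<and> (q(t := g x)) i = g y" if gy: "g y \<noteq> 0"
    proof (cases "y = x")
      case True
      then show ?thesis using ht by (intro exI[of _ t]) auto
    next
      case False
      then obtain i where "1 \<le> i" "i < t" "q i = g y" using V[of y] y gy by auto
      then show ?thesis by (intro exI[of _ i]) auto
    qed
  next
    fix i y assume i: "i < h" and y: "y \<in> {1..n}" "Suc i < h \<or> y < Suc x"
      and "u ((q(t := g x)) i) = c ((q(t := g x)) i) y + w y"
    then have "u (q i) = c (q i) y + w y" using ht by auto
    moreover note searchD(16)[OF S, of i y]
    ultimately show "(vis(x := h)) y \<noteq> 0" using i y h by (auto simp: less_Suc_eq)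
  next
    show "z \<in> {1..n}" "(vis(x := h)) z \<noteq> 0" "g z = 0" if "z \<noteq> 0"
      using searchD(13-15)[OF S that] h by auto
  next
    show "h \<le> Suc t" "1 \<le> Suc t" using ht(1) by simp_all
    show "(q(t := g x)) 0 = m" "(vis(x := h)) 0 = 0" using ht(2,3,5) x by simp_all
  qed
qed

text \<open>The search does not stop at a free symbol; the one found last simply replaces
  \<open>z\<close>.\<close>

lemma search_hit:
  assumes S: "search n c u w m f g vis q h t z x" and m: "partial_matching n c u w m f g"
    and x: "x \<in> {1..n}" and h: "1 \<le> h" and new: "vis x = 0"
    and tight: "u (q (h - 1)) = c (q (h - 1)) x + w x" and g: "g x = 0"
  shows "search n c u w m f g (vis(x := h)) q h t x (Suc x)"
proof -
  note Q = searchD(6-8)[OF S]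
  have V: "vis y \<le> h \<and> u (q (vis y - 1)) = c (q (vis y - 1)) y + w y \<and>
        (g y \<noteq> 0 \<longrightarrow> (\<exists>i. 1 \<le> i \<and> i < t \<and> q i = g y))" if "y \<in> {1..n}" "vis y \<noteq> 0" for y
    using searchD(9-12)[OF S] that by simp
  show ?thesis
    unfolding search_def
  proof (intro conjI ballI allI impI)
    fix i assume i: "1 \<le> i" "i < t"
    show "q i \<in> {1..<m}" using Q i by blast
    have "f (q i) \<noteq> x" using Q[of i] i new by auto
    then show "(vis(x := h)) (f (q i)) \<noteq> 0" "(vis(x := h)) (f (q i)) \<le> i" using i Q[of i] by auto
  next
    fix y assume y: "y \<in> {1..n}" "(vis(x := h)) y \<noteq> 0"
    show "(vis(x := h)) y \<le> h" using y V by auto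
    show "u (q ((vis(x := h)) y - 1)) = c (q ((vis(x := h)) y - 1)) y + w y"
      using V[of y] y tight by auto
    show "x \<noteq> 0" using x by auto
    show "\<exists>i. 1 \<le> i \<and> i < t \<and> q i = g y" if "g y \<noteq> 0"
      using V[of y] y that g by (auto split: if_splits)
  next
    fix i y assume i: "i < h" and y: "y \<in> {1..n}" "Suc i < h \<or> y < Suc x"
      and "u (q i) = c (q i) y + w y"
    moreover note searchD(16)[OF S, of i y]
    ultimately show "(vis(x := h)) y \<noteq> 0" using h by (auto simp: less_Suc_eq)
  next
    show "h \<le> t" "1 \<le> t" "q 0 = m" "inj_on q {..<t}" by (fact searchD(1-4)[OF S])+
    show "(vis(x := h)) 0 = 0" using searchD(5)[OF S] x by simp
    show "x \<in> {1..n}" "(vis(x := h)) x \<noteq> 0" "g x = 0" using x h g by simp_all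
  qed
qed

text \<open>With the queue exhausted and no free symbol found, the reached columns are
  \<open>m\<close> and the partners of visited symbols; \<open>vis 0 = 0\<close> excludes other
  unmatched columns. Matched edges stay tight because a matched column is raised exactly when its
  symbol is.\<close>

lemma dual_step:
  assumes S: "search n c u w m f g vis q t t 0 (Suc n)" and m: "partial_matching n c u w m f g"
    and F: "feasible n c u w" and G: "dual_growth n u w" and mn: "1 \<le> m" "m \<le> n"
    and u': "\<And>j. j \<in> {1..n} \<Longrightarrow> u' j = u j + (if j = m \<or> vis (f j) \<noteq> 0 then 1 else 0)"
    and w': "\<And>x. x \<in> {1..n} \<Longrightarrow> w' x = w x + (if vis x \<noteq> 0 then 1 else 0)"
  shows "partial_matching n c u' w' m f g" "feasible n c u' w'" "dual_growth n u' w'"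
    "sum u' {1..n} + sum w {1..n} = Suc (sum u {1..n} + sum w' {1..n})"
proof -
  note f = partial_matchingD(1-3)[OF m] and f0 = partial_matchingD(4)[OF m]
  note v0 = searchD(5)[OF S]
  have V: "\<exists>i. 1 \<le> i \<and> i < t \<and> q i = g x" "g x \<in> {1..<m}" "f (g x) = x" if "x \<in> {1..n}" "vis x \<noteq> 0" for x
  proof -
    have "g x \<noteq> 0" using searchD(11)[OF S that] by blast
    then show "f (g x) = x" "\<exists>i. 1 \<le> i \<and> i < t \<and> q i = g x"
      using searchD(12)[OF S that] partial_matchingD(5)[OF m that(1)] by simp_all
    then show "g x \<in> {1..<m}" using f0[of "g x"] that by fastforce
  qed
  show "partial_matching n c u' w' m f g"
  proof -
    have "u' j = c j (f j) + w' (f j)" if "j \<in> {1..<m}" for j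
      using f[OF that] u'[of j] w'[of "f j"] that mn by auto
    then show ?thesis using f f0 partial_matchingD(5)[OF m] unfolding partial_matching_def by simp
  qed
  show "feasible n c u' w'"
    unfolding feasible_def
  proof (intro ballI)
    fix j x assume j: "j \<in> {1..n}" and x: "x \<in> {1..n}"
    have le: "u j \<le> c j x + w x" using F j x unfolding feasible_def by blast
    \<comment> \<open>A reached column has been fully scanned, so its tight edges end in visited
      symbols; on other edges integrality leaves room for a raise by one.\<close>
    have "vis x \<noteq> 0" if r: "j = m \<or> vis (f j) \<noteq> 0" and e: "u j = c j x + w x"
    proof -
      have "\<exists>i<t. q i = j"
      proof (cases "j = m")
        case True
        then show ?thesis using S by (intro exI[of _ 0]) (auto simp: search_def)
      next
        case False
        then have "j \<in> {1..<m}" using r v0 f0[of j] by (cases "j \<in> {1..<m}") auto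
        then show ?thesis using V(1)[of "f j"] f[of j] r False by auto
      qed
      then show ?thesis using searchD(16)[OF S] x e by fastforce
    qed
    then have "u j < c j x + w x" if "j = m \<or> vis (f j) \<noteq> 0" "vis x = 0"
      using that le by fastforce
    then show "u' j \<le> c j x + w' x" using u'[OF j] w'[OF x] le by (auto split: if_splits)
  qed
  let ?R = "{j\<in>{1..<m}. vis (f j) \<noteq> 0}" and ?V = "{x\<in>{1..n}. vis x \<noteq> 0}"
  \<comment> \<open>No visited symbol is free, so the matching pairs visited symbols with the
    reached columns other than \<open>m\<close>. The root accounts for the gain of one.\<close>
  have "?V = f ` ?R"
  proof (intro equalityI subsetI)
    fix x assume "x \<in> ?V"
    then show "x \<in> f ` ?R" using V[of x] by (intro image_eqI[of _ _ "g x"]) auto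
  qed (use f in auto)
  moreover have "inj_on f ?R" using f(2) by (intro inj_on_inverseI[of _ g]) auto
  ultimately have card: "card ?V = card ?R" by (simp add: card_image)
  have R: "{j\<in>{1..n}. j = m \<or> vis (f j) \<noteq> 0} = insert m ?R"
  proof (intro equalityI subsetI)
    fix j assume "j \<in> {j\<in>{1..n}. j = m \<or> vis (f j) \<noteq> 0}"
    then show "j \<in> insert m ?R" using f0[of j] v0 by fastforce
  qed (use mn in auto)
  have "sum u' {1..n} = sum u {1..n} + card {j\<in>{1..n}. j = m \<or> vis (f j) \<noteq> 0}"
    using u' by (simp add: sum.distrib sum.If_cases Int_def)
  then have su: "sum u' {1..n} = sum u {1..n} + Suc (card ?R)" unfolding R by simp
  have sw: "sum w' {1..n} = sum w {1..n} + card ?V"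
    using w' by (simp add: sum.distrib sum.If_cases Int_def)
  show s: "sum u' {1..n} + sum w {1..n} = Suc (sum u {1..n} + sum w' {1..n})"
    using su sw card by simp
  show "dual_growth n u' w'"
    unfolding dual_growth_def
  proof (intro conjI ballI)
    show "sum w' {1..n} \<le> sum u' {1..n}" using s G unfolding dual_growth_def by linarith
    fix j assume j: "j \<in> {1..n}"
    then have g: "u j + sum w {1..n} \<le> sum u {1..n}" "w j + sum w {1..n} \<le> sum u {1..n}"
      using G unfolding dual_growth_def by auto
    show "u' j + sum w' {1..n} \<le> sum u' {1..n}"
      using g u'[OF j] s by (auto split: if_splits)
    show "w' j + sum w' {1..n} \<le> sum u' {1..n}"
      using g w'[OF j] s by (auto split: if_splits)
  qed
qed

section \<open>Flipping the augmenting path\<close>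

text \<open>The state while the alternating path ending in the symbol \<open>z\<close> is being flipped from its end:
  \<open>z\<close> is the symbol that still has to be given to its predecessor, and \<open>0\<close> once the root has
  been served. \<open>f0\<close> is the matching before the augmentation.\<close>

definition augmenting ::
  "nat \<Rightarrow> (nat \<Rightarrow> nat \<Rightarrow> nat) \<Rightarrow> (nat \<Rightarrow> nat) \<Rightarrow> (nat \<Rightarrow> nat) \<Rightarrow> nat \<Rightarrow> (nat \<Rightarrow> nat) \<Rightarrow> (nat \<Rightarrow> nat) \<Rightarrow>
   (nat \<Rightarrow> nat) \<Rightarrow> (nat \<Rightarrow> nat) \<Rightarrow> (nat \<Rightarrow> nat) \<Rightarrow> nat \<Rightarrow> bool"
  where "augmenting n c u w m vis q f0 f g z \<longleftrightarrow>
     (\<forall>j. f j \<noteq> 0 \<longrightarrow> j \<in> {1..m} \<and> f j \<in> {1..n} \<and> g (f j) = j \<and> u j = c j (f j) + w (f j) \<and> f j \<noteq> z) \<and>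
     (\<forall>x\<in>{1..n}. x \<noteq> z \<longrightarrow> g x \<noteq> 0 \<longrightarrow> f (g x) = x) \<and>
     (\<forall>j\<in>{1..<m}. f j \<noteq> 0) \<and> (z = 0 \<longrightarrow> f m \<noteq> 0) \<and>
     (z \<noteq> 0 \<longrightarrow> z \<in> {1..n} \<and> vis z \<noteq> 0 \<and> (\<forall>i<vis z. f (q i) = f0 (q i)))"

lemma augmentingD:
  assumes "augmenting n c u w m vis q f0 f g z"
  shows "\<And>j. f j \<noteq> 0 \<Longrightarrow> j \<in> {1..m}" "\<And>j. f j \<noteq> 0 \<Longrightarrow> f j \<in> {1..n}"
    and "\<And>j. f j \<noteq> 0 \<Longrightarrow> g (f j) = j" "\<And>j. f j \<noteq> 0 \<Longrightarrow> u j = c j (f j) + w (f j)"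
    and "\<And>j. f j \<noteq> 0 \<Longrightarrow> f j \<noteq> z"
    and "\<And>x. x \<in> {1..n} \<Longrightarrow> x \<noteq> z \<Longrightarrow> g x \<noteq> 0 \<Longrightarrow> f (g x) = x"
    and "\<And>j. j \<in> {1..<m} \<Longrightarrow> f j \<noteq> 0" "z = 0 \<Longrightarrow> f m \<noteq> 0"
    and "z \<noteq> 0 \<Longrightarrow> z \<in> {1..n}" "z \<noteq> 0 \<Longrightarrow> vis z \<noteq> 0"
    and "\<And>i. z \<noteq> 0 \<Longrightarrow> i < vis z \<Longrightarrow> f (q i) = f0 (q i)"
  using assms unfolding augmenting_def by simp_all

lemma augmenting_init:
  assumes "search n c u w m f g vis q h t z x" and m: "partial_matching n c u w m f g" and "z \<noteq> 0"
  shows "augmenting n c u w m vis q f f g z"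
proof -
  note z = searchD(13-15)[OF assms(1,3)]
  note f = partial_matchingD(1-3)[OF m] and f0 = partial_matchingD(4)[OF m]
  have j: "j \<in> {1..<m}" if "f j \<noteq> 0" for j
    using f0[of j] that by (cases "j \<in> {1..<m}") simp_all
  have ne: "f j \<noteq> z" if "f j \<noteq> 0" for j using j[OF that] f(2)[of j] z by auto
  have pos: "f j \<noteq> 0" if "j \<in> {1..<m}" for j using f(1)[OF that] by auto
  show ?thesis
    unfolding augmenting_def
  proof (intro conjI allI ballI impI)
    fix j assume "f j \<noteq> 0"
    note j = j[OF this] ne[OF this]
    show "j \<in> {1..m}" "f j \<in> {1..n}" "g (f j) = j" "u j = c j (f j) + w (f j)" "f j \<noteq> z"
      using j f[OF j(1)] by auto
  next
    show "f (g x) = x" if "x \<in> {1..n}" "g x \<noteq> 0" for x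
      using partial_matchingD(5)[OF m that] .
  next
    show "z \<in> {1..n}" "vis z \<noteq> 0" by (fact z)+
    show "f m \<noteq> 0" if "z = 0" using that \<open>z \<noteq> 0\<close> by simp
  qed (auto simp: pos)
qed

text \<open>The predecessor \<open>j\<close> takes \<open>z\<close>, and its old partner becomes
  pending. That partner was reached from a position below that of \<open>j\<close>, so
  \<open>vis\<close> decreases; positions below \<open>vis z\<close> still carry the original
  matching, to which the search invariant applies.\<close>

lemma augmenting_step:
  assumes A: "augmenting n c u w m vis q f0 f g z" and z: "z \<noteq> 0"
    and S: "search n c u w m f0 g0 vis q h t z0 x0" and m: "partial_matching n c u w m f0 g0" "1 \<le> m"
  defines "j \<equiv> q (vis z - 1)"
  shows "augmenting n c u w m vis q f0 (f(j := z)) (g(z := j)) (f j)" "vis (f j) < vis z"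
    "j \<in> {1..m}"
proof -
  note zz = augmentingD(9,10)[OF A z] and same = augmentingD(11)[OF A z]
  note f = augmentingD(1-5)[OF A] and g = augmentingD(6)[OF A]
  define i where "i = vis z - 1"
  have "vis z \<le> h" "h \<le> t" using searchD(1,9)[OF S] zz by simp_all
  then have i: "i < vis z" "i < t" using zz by (auto simp: i_def)
  have fj: "f j = f0 j" and ji: "j = q i" using same[OF i(1)] by (auto simp: j_def i_def)
  show jm: "j \<in> {1..m}" using search_queue(2)[OF S m(2) i(2)] by (simp add: ji)
  have tight: "u j = c j z + w z" using searchD(10)[OF S zz] by (simp add: j_def)
  note inj = searchD(4)[OF S] and q0 = searchD(3)[OF S] and v0 = searchD(5)[OF S]
  \<comment> \<open>Position \<open>0\<close> holds the root, which is unmatched in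
    \<open>f0\<close>.\<close>
  have pos: "1 \<le> i" if "f j \<noteq> 0"
  proof (rule ccontr)
    assume "\<not> 1 \<le> i"
    then have "j = m" using q0 ji by (cases i) auto
    then have "f0 j = 0" using partial_matchingD(4)[OF m(1)] by simp
    then show False using that fj by simp
  qed
  have old: "vis (f j) \<noteq> 0" "vis (f j) \<le> i" if "f j \<noteq> 0"
    using searchD(7,8)[OF S pos[OF that] i(2)] by (simp_all add: fj flip: ji)
  show "vis (f j) < vis z" using old i v0 zz by (cases "f j = 0") auto
  \<comment> \<open>All columns below \<open>m\<close> remain matched throughout, so an unmatched
    predecessor can only be the root.\<close>
  have root: "j = m" if "f j = 0"
  proof (rule ccontr)
    assume "j \<noteq> m"
    then have "j \<in> {1..<m}" using jm by auto
    then have "f j \<noteq> 0" by (rule augmentingD(7)[OF A])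
    then show False using that by simp
  qed
  show "augmenting n c u w m vis q f0 (f(j := z)) (g(z := j)) (f j)"
    unfolding augmenting_def
  proof (intro conjI allI ballI impI)
    fix k assume k: "(f(j := z)) k \<noteq> 0"
    show "k \<in> {1..m}" using k f(1)[of k] jm by (auto split: if_splits)
    show "(f(j := z)) k \<in> {1..n}" using k f(2)[of k] zz by (auto split: if_splits)
    show "(g(z := j)) ((f(j := z)) k) = k" using k f(3,5)[of k] by (auto split: if_splits)
    show "u k = c k ((f(j := z)) k) + w ((f(j := z)) k)"
      using k f(4)[of k] tight by (auto split: if_splits)
    show "(f(j := z)) k \<noteq> f j" using k f(3)[of k] f(3,5)[of j] z by (auto split: if_splits)
  next
    fix x assume "x \<in> {1..n}" "x \<noteq> f j" "(g(z := j)) x \<noteq> 0"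
    then show "(f(j := z)) ((g(z := j)) x) = x" using g[of x] by auto
  next
    fix k assume "k \<in> {1..<m}"
    then show "(f(j := z)) k \<noteq> 0" using augmentingD(7)[OF A] z by auto
  next
    assume "f j = 0" then show "(f(j := z)) m \<noteq> 0" using root z by simp
  next
    assume a: "f j \<noteq> 0"
    show "f j \<in> {1..n}" "vis (f j) \<noteq> 0" using f(2)[OF a] old[OF a] by auto
    fix i' assume i': "i' < vis (f j)"
    then have "i' < i" using old[OF a] by simp
    then have "q i' \<noteq> q i" using inj i(2) by (auto simp: inj_on_def)
    then show "(f(j := z)) (q i') = f0 (q i')" using same[of i'] \<open>i' < i\<close> i by (simp add: ji)
  qed
qed

lemma augmenting_done:
  assumes A: "augmenting n c u w m vis q f0 f g 0"
  shows "partial_matching n c u w (Suc m) f g"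
proof -
  note f = augmentingD(1-4)[OF A]
  have "f j \<noteq> 0" if "j \<in> {1..<Suc m}" for j
    using augmentingD(7,8)[OF A] that by (cases "j = m") auto
  moreover have "f j = 0" if "j \<notin> {1..<Suc m}" for j
    using f(1)[of j] that by (auto simp: less_Suc_eq_le)
  moreover have "f (g x) = x" if "x \<in> {1..n}" "g x \<noteq> 0" for x
    using augmentingD(6)[OF A, of x] that by simp
  ultimately show ?thesis
    using f(2-4) unfolding partial_matching_def by blast
qed


section \<open>The programs\<close>

text \<open>Names of the arrays. \<open>a_u\<close> to \<open>a_z\<close> hold the data of the primal-dual method under the names
  used above, and \<open>a_cost\<close> its cost matrix. \<open>a_pair\<close> marks the pairs in the first \<open>k\<close> rows, and
  \<open>a_forb\<close> holds \<open>n + 1\<close> for forbidden column-symbol pairs. Everything is indexed from \<open>1\<close> on, and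
  matrix entry \<open>(j, x)\<close> has address \<open>j * n + x\<close>; only the input and output arrays have the
  addresses \<open>Pos\<close> fixed by \<open>store\<close> and \<open>fetch\<close>.\<close>

abbreviation (input) "a_n \<equiv> 0::nat"
abbreviation (input) "a_k \<equiv> 1::nat"
abbreviation (input) "a_A \<equiv> 2::nat"
abbreviation (input) "a_B \<equiv> 3::nat"
abbreviation (input) "a_out \<equiv> 4::nat"
abbreviation (input) "a_pair \<equiv> 5::nat"
abbreviation (input) "a_cost \<equiv> 6::nat"
abbreviation (input) "a_u \<equiv> 7::nat"
abbreviation (input) "a_w \<equiv> 8::nat"
abbreviation (input) "a_f \<equiv> 9::nat"
abbreviation (input) "a_g \<equiv> 10::nat"
abbreviation (input) "a_vis \<equiv> 11::nat"
abbreviation (input) "a_q \<equiv> 12::nat"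
abbreviation (input) "a_m \<equiv> 13::nat"
abbreviation (input) "a_h \<equiv> 14::nat"
abbreviation (input) "a_t \<equiv> 15::nat"
abbreviation (input) "a_z \<equiv> 16::nat"
abbreviation (input) "a_x \<equiv> 17::nat"
abbreviation (input) "a_j \<equiv> 18::nat"
abbreviation (input) "a_y \<equiv> 19::nat"
abbreviation (input) "a_forb \<equiv> 20::nat"

abbreviation Inc :: "exp \<Rightarrow> exp" where "Inc e \<equiv> Add e (Const 1)"

abbreviation Cell :: "exp \<Rightarrow> exp \<Rightarrow> exp" where "Cell j x \<equiv> Add (Mul j (Var a_n)) x"

definition table :: "nat \<Rightarrow> (nat \<Rightarrow> nat) \<Rightarrow> nat \<Rightarrow> nat \<Rightarrow> nat" where
  "table n C j x = C (j * n + x)"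

text \<open>The tested sum vanishes exactly if the symbol is unvisited and the edge tight: by
  feasibility the truncated difference is the true slack.\<close>

definition Scan :: prog where
  "Scan = Seq (Assign a_j (Read a_q (Var a_h))) (Seq (Assign a_h (Inc (Var a_h)))
     (For a_x a_n
       (Cond (Add (Read a_vis (Var a_x))
           (Sub (Add (Read a_cost (Cell (Var a_j) (Var a_x))) (Read a_w (Var a_x))) (Read a_u (Var a_j))))
         Skip
         (Seq (Write a_vis (Var a_x) (Var a_h))
           (Cond (Read a_g (Var a_x))
             (Seq (Write a_q (Var a_t) (Read a_g (Var a_x))) (Assign a_t (Inc (Var a_t))))
             (Assign a_z (Var a_x)))))))"

definition Search :: prog where
  "Search = Seq (For a_x a_n (Write a_vis (Var a_x) (Const 0)))
     (Seq (Write a_q (Const 0) (Var a_m)) (Seq (Assign a_h (Const 0)) (Seq (Assign a_t (Const 1))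
     (Seq (Assign a_z (Const 0)) (While (Sub (Var a_t) (Var a_h)) Scan)))))"

definition Augment :: prog where
  "Augment = While (Var a_z)
     (Seq (Assign a_j (Read a_q (Sub (Read a_vis (Var a_z)) (Const 1))))
     (Seq (Assign a_y (Read a_f (Var a_j)))
     (Seq (Write a_f (Var a_j) (Var a_z))
     (Seq (Write a_g (Var a_z) (Var a_j))
     (Assign a_z (Var a_y))))))"

text \<open>The root is raised separately. Being unmatched, it has \<open>f m = 0\<close> and
  \<open>vis 0 = 0\<close>, so the loop does not raise it again.\<close>

definition Dual_Step :: prog where
  "Dual_Step = Seq (Write a_u (Var a_m) (Inc (Read a_u (Var a_m))))
     (For a_x a_n (Seq
       (Cond (Read a_vis (Var a_x)) (Write a_w (Var a_x) (Inc (Read a_w (Var a_x)))) Skip)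
       (Cond (Read a_vis (Read a_f (Var a_x))) (Write a_u (Var a_x) (Inc (Read a_u (Var a_x)))) Skip)))"

definition Match :: prog where
  "Match = Seq (Assign a_m (Const 1)) (While (Sub (Inc (Var a_n)) (Var a_m))
     (Seq Search (Cond (Var a_z) (Seq Augment (Assign a_m (Inc (Var a_m)))) Dual_Step)))"

lemma writes_Scan [simp]: "writes Scan = {a_j, a_h, a_x, a_vis, a_q, a_t, a_z}"
  by (auto simp: Scan_def)

lemma writes_Search [simp]: "writes Search = {a_j, a_h, a_x, a_vis, a_q, a_t, a_z}"
  by (auto simp: Search_def)

lemma writes_Augment [simp]: "writes Augment = {a_j, a_y, a_f, a_g, a_z}"
  by (auto simp: Augment_def)

lemma writes_Dual_Step [simp]: "writes Dual_Step = {a_x, a_u, a_w}"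
  by (auto simp: Dual_Step_def)

lemma writes_Match [simp]:
  "writes Match = {a_m, a_j, a_h, a_x, a_vis, a_q, a_t, a_z, a_y, a_f, a_g, a_u, a_w}"
  by (auto simp: Match_def)

section \<open>Correctness of the matching program\<close>

lemma runs_Scan:
  fixes n C
  defines "c \<equiv> table n C"
  assumes N: "n \<le> N" and M: "n + 2 \<le> M" and m: "1 \<le> m" "m \<le> n"
    and F: "feasible n c u w" and P: "partial_matching n c u w m f g"
    and s: "s a_n 0 = n" "s a_cost = C" "s a_u = u" "s a_w = w" "s a_f = f" "s a_g = g"
    and S: "search n c u w m f g (s a_vis) (s a_q) (s a_h 0) (s a_t 0) (s a_z 0) (Suc n)"
    and ht: "s a_h 0 < s a_t 0"
  shows "runs W M N Scan s (\<lambda>s'. s' a_h 0 = Suc (s a_h 0) \<and>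
    search n c u w m f g (s' a_vis) (s' a_q) (s' a_h 0) (s' a_t 0) (s' a_z 0) (Suc n))"
proof -
  define h where "h = Suc (s a_h 0)"
  have tm: "s a_t 0 \<le> m" using search_queue(1)[OF S m(1)] .
  have j: "s a_q (s a_h 0) \<in> {1..m}" using search_queue(2)[OF S m(1) ht] .
  \<comment> \<open>The head has been advanced already, so the column being scanned is
    \<open>q (h - 1)\<close>; pushes go to positions from \<open>h\<close> on and leave it in
    place.\<close>
  let ?I = "\<lambda>x s'. s' a_h 0 = h \<and> s' a_q (h - 1) = s' a_j 0 \<and> s' a_j 0 \<in> {1..n} \<and>
    search n c u w m f g (s' a_vis) (s' a_q) h (s' a_t 0) (s' a_z 0) x"
  show ?thesis
    unfolding Scan_def
  proof (intro runs_Seq runs_Assign, goal_cases)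
    case 1
    then show ?case using j m M by simp
  next
    case 2
    then show ?case using ht tm m M by simp
  next
    case 3
    show ?case
    proof (rule runs_For[where I = ?I and m = n], goal_cases)
      case 7
      then show ?case using search_next[OF S ht] j m by (simp add: h_def)
    next
      case (8 x s')
      have fr: "s' a_n 0 = n" "s' a_cost = C" "s' a_u = u" "s' a_w = w" "s' a_f = f" "s' a_g = g"
        using 8(5) s by simp_all
      have I: "s' a_h 0 = h" "s' a_q (h - 1) = s' a_j 0" "s' a_j 0 \<in> {1..n}"
        "search n c u w m f g (s' a_vis) (s' a_q) h (s' a_t 0) (s' a_z 0) x" using 8(3) by auto
      have x: "x \<in> {1..n}" "s' a_x 0 = x" using 8 by auto
      have h: "1 \<le> h" "h \<le> s' a_t 0" using searchD(1)[OF I(4)] by (auto simp: h_def)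
      have ht': "h - Suc 0 \<noteq> s' a_t 0" using h by simp
      have t: "s' a_t 0 \<le> n" using search_queue(1)[OF I(4) m(1)] m by simp
      have le: "u (s' a_j 0) \<le> c (s' a_j 0) x + w x" using F I x unfolding feasible_def by blast
      have Ceq: "C (s' a_j 0 * n + x) = c (s' a_j 0) x" by (simp add: c_def table_def)
      show ?case
      proof (rule runs_Cond, goal_cases)
        case 1
        then have "s' a_vis x \<noteq> 0 \<or> u (s' a_q (h - 1)) \<noteq> c (s' a_q (h - 1)) x + w x"
          using fr x I(1,2) Ceq by auto
        from search_skip[OF I(4) this] show ?case
          by (intro runs_Skip) (use I in auto)
      next
        case 2
        then have new: "s' a_vis x = 0" and tight: "u (s' a_q (h - 1)) = c (s' a_q (h - 1)) x + w x"
          using fr x I(1,2) Ceq le by auto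
        show ?case
        proof (intro runs_Seq runs_Write runs_Cond runs_Assign, goal_cases)
          case 1
          then show ?case using h t I M by simp
        next
          case 2
          then have g: "g x \<noteq> 0" using fr x by simp
          note push = search_push[OF I(4) P x(1) h(1) new tight g]
          \<comment> \<open>Position \<open>t\<close> of the extended queue holds
            \<open>g x\<close>, so the bound on queue entries limits the value to be stored.\<close>
          from search_queue(2)[OF push m(1), of "s' a_t 0"] have "g x \<le> m" by simp
          then show ?case using fr x m M by simp
        next
          case 3
          then show ?case using t M by simp
        next
          case 4
          then have g: "g x \<noteq> 0" using fr x by simp
          note push = search_push[OF I(4) P x(1) h(1) new tight g]
          then show ?case using fr x I h ht' by simp
        next
          case 5
          then show ?case using x M by simp
        next
          case 6
          then have g: "g x = 0" using fr x by simp
          note hit = search_hit[OF I(4) P x(1) h(1) new tight g]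
          then show ?case using fr x I h by simp
        qed
      qed
    next
      case (9 s')
      then show ?case by (simp add: h_def)
    qed (use s N M in auto)
  qed
qed

text \<open>Each scan takes one column out of a queue that never exceeds \<open>m \<le> n\<close>
  columns, whence the variant \<open>n - h\<close>.\<close>

lemma runs_Search:
  fixes n C
  defines "c \<equiv> table n C"
  assumes N: "n \<le> N" and M: "n + 2 \<le> M" and m: "1 \<le> m" "m \<le> n"
    and F: "feasible n c u w" and P: "partial_matching n c u w m f g"
    and s: "s a_n 0 = n" "s a_cost = C" "s a_u = u" "s a_w = w" "s a_f = f" "s a_g = g" "s a_m 0 = m"
    and v0: "s a_vis 0 = 0"
  shows "runs W M N Search s (\<lambda>s'.
    search n c u w m f g (s' a_vis) (s' a_q) (s' a_t 0) (s' a_t 0) (s' a_z 0) (Suc n))"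
  unfolding Search_def
proof (intro runs_Seq, rule runs_For[where m = n and
      I = "\<lambda>x s'. s' a_vis 0 = 0 \<and> (\<forall>y\<in>{1..<x}. s' a_vis y = 0)"], goal_cases)
  case (8 x s')
  then show ?case by (intro runs_Write) (auto simp: less_Suc_eq)
next
  case (9 s')
  show ?case
  proof (intro runs_Seq runs_Write runs_Assign, goal_cases)
    case 5
    let ?s = "\<lambda>x. (s'(a_q := (s' a_q)(val s' (Const 0) := val s' (Var a_m)))) x"
    show ?case
    proof (rule runs_While[where \<mu> = "\<lambda>s'. n - s' a_h 0" and I = "\<lambda>s'.
        search n c u w m f g (s' a_vis) (s' a_q) (s' a_h 0) (s' a_t 0) (s' a_z 0) (Suc n)"], goal_cases)
      case 1
      have "search n c u w m f g (s' a_vis) ((s' a_q)(0 := m)) 0 1 0 (Suc n)"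
        using 9(1) by (intro search_init) (auto simp: less_Suc_eq_le)
      then show ?case using 9(2) s by simp
    next
      case 2
      then show ?case using N by simp
    next
      case (3 s'')
      then have ht: "s'' a_h 0 < s'' a_t 0" by simp
      have "s'' a_t 0 \<le> n" using search_queue(1)[OF 3(1) m(1)] m by simp
      have "runs W M N Scan s'' (\<lambda>s'. s' a_h 0 = Suc (s'' a_h 0) \<and>
          search n c u w m f g (s' a_vis) (s' a_q) (s' a_h 0) (s' a_t 0) (s' a_z 0) (Suc n))"
        unfolding c_def using 3 9 s ht
        by (intro runs_Scan[OF N M m F[unfolded c_def] P[unfolded c_def]]) (simp_all add: c_def)
      then show ?case
        by (rule runs_mono) (use ht \<open>s'' a_t 0 \<le> n\<close> in auto)
    next
      case (4 s'')
      then have "s'' a_t 0 \<le> s'' a_h 0" by simp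
      with searchD(1)[OF 4(1)] 4(1) show ?case by (metis le_antisym)
    qed
  qed (use 9 s m M in auto)
qed (use s N M v0 in auto)

text \<open>The variant is \<open>vis\<close> at the pending symbol: it decreases along the path and
  starts at most at \<open>t \<le> m\<close>.\<close>

lemma runs_Augment:
  fixes n C
  defines "c \<equiv> table n C"
  assumes N: "n \<le> N" and M: "n + 2 \<le> M" and m: "1 \<le> m" "m \<le> n"
    and P: "partial_matching n c u w m f g"
    and S: "search n c u w m f g vis q t t z (Suc n)" and z: "z \<noteq> 0"
    and s: "s a_f = f" "s a_g = g" "s a_vis = vis" "s a_q = q" "s a_z 0 = z"
  shows "runs W M N Augment s (\<lambda>s'. partial_matching n c u w (Suc m) (s' a_f) (s' a_g))"
  unfolding Augment_def
proof (rule runs_While[where \<mu> = "\<lambda>s'. vis (s' a_z 0)" and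
      I = "\<lambda>s'. augmenting n c u w m vis q f (s' a_f) (s' a_g) (s' a_z 0)"], goal_cases)
  case 1
  then show ?case using augmenting_init[OF S P z] s by simp
next
  case 2
  have "vis z \<le> t" "t \<le> m" using searchD(9)[OF S] searchD(13,14)[OF S z] search_queue(1)[OF S m(1)] by auto
  then show ?case using s m N by simp
next
  case (3 s')
  then have z': "s' a_z 0 \<noteq> 0" by simp
  have fr: "s' a_vis = vis" "s' a_q = q" using 3(3) s by simp_all
  define j where "j = q (vis (s' a_z 0) - 1)"
  have j': "q (vis (s' a_z 0) - Suc 0) = j" by (simp add: j_def)
  note step = augmenting_step[OF 3(1) z' S P m(1), folded j_def]
  have "s' a_z 0 \<in> {1..n}" using augmentingD(9)[OF 3(1) z'] .
  moreover have "s' a_f j \<le> n" using augmentingD(2)[OF 3(1), of j] by (cases "s' a_f j = 0") auto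
  ultimately show ?case
    using step m M by (intro runs_Seq runs_Write runs_Assign) (auto simp: fr j')
next
  case (4 s')
  then show ?case using augmenting_done[of n c u w m vis q f "s' a_f" "s' a_g"] by simp
qed

lemma runs_Dual_Step:
  assumes N: "n \<le> N" and M: "n + 2 \<le> M" and m: "1 \<le> m" "m \<le> n"
    and u: "\<And>j. j \<in> {1..n} \<Longrightarrow> u j \<le> n \<and> w j \<le> n"
    and s: "s a_n 0 = n" "s a_u = u" "s a_w = w" "s a_f = f" "s a_vis = vis" "s a_m 0 = m"
    and fm: "vis (f m) = 0"
  shows "runs W M N Dual_Step s (\<lambda>s'. (\<forall>j\<in>{1..n}.
      s' a_u j = u j + (if j = m \<or> vis (f j) \<noteq> 0 then 1 else 0) \<and>
      s' a_w j = w j + (if vis j \<noteq> 0 then 1 else 0)))"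
  unfolding Dual_Step_def
proof (intro runs_Seq runs_Write, goal_cases)
  case 1
  then show ?case using s u[of m] m M by simp
next
  case 2
  show ?case
  proof (rule runs_For[where m = n and I = "\<lambda>x s'. \<forall>j\<in>{1..n}.
      s' a_u j = u j + (if j = m \<or> j < x \<and> vis (f j) \<noteq> 0 then 1 else 0) \<and>
      s' a_w j = w j + (if j < x \<and> vis j \<noteq> 0 then 1 else 0)"], goal_cases)
    case (8 x s')
    have fr: "s' a_f = f" "s' a_vis = vis" using 8(5) s by simp_all
    have x: "x \<in> {1..n}" using 8 by simp
    have I: "s' a_u j = u j + (if j = m \<or> j < x \<and> vis (f j) \<noteq> 0 then 1 else 0)"
      "s' a_w j = w j + (if j < x \<and> vis j \<noteq> 0 then 1 else 0)" if "j \<in> {1..n}" for j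
      using 8(3) that by auto
    show ?case
      by (intro runs_Seq runs_Write runs_Cond runs_Skip)
        (use 8(4) fr x I[of x] I u[of x] M fm in \<open>auto simp: less_Suc_eq\<close>)
  next
    case (9 s')
    then show ?case by (auto simp: less_Suc_eq_le)
  qed (use s N M in \<open>auto simp: less_Suc_eq\<close>)
qed

text \<open>The variant adds the number of unmatched columns to the gap between \<open>n\<close> and
  the dual objective. An augmentation lowers the first by one, a dual step the second; together they
  start at \<open>2 * n\<close>.\<close>

lemma runs_Match:
  fixes n C
  defines "c \<equiv> table n C"
  assumes N: "2 * n \<le> N" and M: "n + 2 \<le> M"
    and dual_bound: "\<And>u w. feasible n c u w \<Longrightarrow> sum u {1..n} \<le> sum w {1..n} + n"
    and s: "s a_n 0 = n" "s a_cost = C"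
    and zero: "\<And>a. a \<in> {a_u, a_w, a_f, a_g, a_vis} \<Longrightarrow> s a = (\<lambda>_. 0)"
  shows "runs W M N Match s (\<lambda>s'. feasible n c (s' a_u) (s' a_w) \<and>
    partial_matching n c (s' a_u) (s' a_w) (Suc n) (s' a_f) (s' a_g))"
  unfolding Match_def
proof (intro runs_Seq runs_Assign, goal_cases)
  case 1
  then show ?case using M by simp
next
  case 2
  let ?I = "\<lambda>s. 1 \<le> s a_m 0 \<and> s a_m 0 \<le> Suc n \<and> feasible n c (s a_u) (s a_w) \<and>
    dual_growth n (s a_u) (s a_w) \<and> s a_vis 0 = 0 \<and>
    partial_matching n c (s a_u) (s a_w) (s a_m 0) (s a_f) (s a_g)"
  let ?\<mu> = "\<lambda>s. (n + 1 - s a_m 0) + (n + sum (s a_w) {1..n} - sum (s a_u) {1..n})"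
  show ?case
  proof (rule runs_While[where \<mu> = ?\<mu> and I = ?I], goal_cases)
    case 1
    then show ?case using zero
      by (simp add: feasible_def dual_growth_def partial_matching_def)
  next
    case 2
    then show ?case using zero N by simp
  next
    case (3 s')
    define m where "m = s' a_m 0"
    define u w f g where "u = s' a_u" and "w = s' a_w" and "f = s' a_f" and "g = s' a_g"
    note defs = m_def u_def w_def f_def g_def
    have fr: "s' a_n 0 = n" "s' a_cost = C" using 3(3) s by simp_all
    have m: "1 \<le> m" "m \<le> n" and F: "feasible n c u w" and G: "dual_growth n u w"
      and v0: "s' a_vis 0 = 0" and P: "partial_matching n c u w m f g"
      using 3(1,2) fr by (auto simp: defs)
    have D: "sum u {1..n} \<le> sum w {1..n} + n" using dual_bound[OF F] .
    \<comment> \<open>No potential exceeds the dual objective, which is at most \<open>n\<close>; a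
      raise therefore stays within the memory bound.\<close>
    have ub: "u j \<le> n \<and> w j \<le> n" if "j \<in> {1..n}" for j
    proof -
      have "u j + sum w {1..n} \<le> sum u {1..n}" "w j + sum w {1..n} \<le> sum u {1..n}"
        using G that unfolding dual_growth_def by blast+
      then show ?thesis using D by linarith
    qed
    have Nn: "n \<le> N" using N by simp
    have fm: "f m = 0" using partial_matchingD(4)[OF P, of m] by simp
    have search: "runs W M N Search s' (\<lambda>s''.
        search n c u w m f g (s'' a_vis) (s'' a_q) (s'' a_t 0) (s'' a_t 0) (s'' a_z 0) (Suc n))"
      unfolding c_def
      by (rule runs_Search[OF Nn M m F[unfolded c_def] P[unfolded c_def]]) (use fr v0 in \<open>simp_all add: defs\<close>)
    show ?case
    proof (rule runs_Seq, rule runs_mono[OF search], goal_cases)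
      case (1 t)
      let ?t = "t a_t 0"
      have frt: "t a_n 0 = n" "t a_cost = C" "t a_u = u" "t a_w = w" "t a_f = f" "t a_g = g" "t a_m 0 = m"
        using 1(1) fr by (simp_all add: defs)
      note S = 1(2)
      show ?case
      proof (rule runs_Cond, goal_cases)
        case 1
        then have z: "t a_z 0 \<noteq> 0" by simp
        have "runs W M N Augment t (\<lambda>t'. partial_matching n c u w (Suc m) (t' a_f) (t' a_g))"
          unfolding c_def
          by (rule runs_Augment[OF Nn M m P[unfolded c_def] S[unfolded c_def] z])
            (use frt in simp_all)
        then show ?case
        proof (intro runs_Seq, elim runs_mono, goal_cases)
          case (1 t')
          then show ?case
            using frt m M F G searchD(5)[OF S] by (intro runs_Assign) (auto simp flip: defs)
        qed
      next
        case 2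
        then have S0: "search n c u w m f g (t a_vis) (t a_q) ?t ?t 0 (Suc n)" using S by simp
        have "runs W M N Dual_Step t (\<lambda>t'. (\<forall>j\<in>{1..n}.
            t' a_u j = u j + (if j = m \<or> t a_vis (f j) \<noteq> 0 then 1 else 0) \<and>
            t' a_w j = w j + (if t a_vis j \<noteq> 0 then 1 else 0)))"
          by (rule runs_Dual_Step[OF Nn M m ub]) (use frt fm searchD(5)[OF S] in simp_all)
        then show ?case
        proof (elim runs_mono, goal_cases)
          case (1 t')
          have fr': "t' a_f = f" "t' a_g = g" "t' a_m 0 = m" "t' a_vis = t a_vis"
            using 1(1) frt by simp_all
          have upd: "t' a_u j = u j + (if j = m \<or> t a_vis (f j) \<noteq> 0 then 1 else 0)"
            "t' a_w j = w j + (if t a_vis j \<noteq> 0 then 1 else 0)" if "j \<in> {1..n}" for j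
            using 1(2) that by simp_all
          note step = dual_step[where u' = "t' a_u" and w' = "t' a_w", OF S0 P F G m upd]
          \<comment> \<open>The bound for the new potentials shows that the gap was positive before,
            so the truncated difference really drops.\<close>
          have "sum (t' a_u) {1..n} \<le> sum (t' a_w) {1..n} + n" using dual_bound[OF step(2)] .
          then show ?case using step D m fr' searchD(5)[OF S] by (simp flip: defs)
        qed
      qed
    qed
  next
    case (4 s')
    then have "s' a_n 0 = n" using s by simp
    then have "s' a_m 0 = Suc n" using 4 by simp
    then show ?case using 4 by simp
  qed
qed

section \<open>Reading the input, building the costs, writing the output\<close>

definition Pos :: "exp \<Rightarrow> exp \<Rightarrow> exp" where
  "Pos i j = Add (Mul (Sub i (Const 1)) (Var a_n)) (Sub j (Const 1))"

definition Load :: prog where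
  "Load = For a_y a_k (For a_x a_n
     (Seq (Write a_pair (Cell (Read a_A (Pos (Var a_y) (Var a_x))) (Read a_B (Pos (Var a_y) (Var a_x)))) (Const 1))
     (Seq (Write a_forb (Cell (Var a_x) (Read a_A (Pos (Var a_y) (Var a_x)))) (Inc (Var a_n)))
       (Write a_out (Pos (Var a_y) (Var a_x)) (Read a_A (Pos (Var a_y) (Var a_x)))))))"

text \<open>Here \<open>a_y\<close> is a column and \<open>a_x\<close> a candidate symbol for its
  new cell, unlike in \<open>Load\<close>, where \<open>a_y\<close> is a row and \<open>a_x\<close>
  a column.\<close>

definition Pair_Bit :: exp where
  "Pair_Bit = Read a_pair (Cell (Var a_x) (Read a_B (Pos (Inc (Var a_k)) (Var a_y))))"

text \<open>\<open>b\<close> selects the problem: the cost is \<open>\<bar>b - Pair_Bit\<bar>\<close>, so old pairs are penalized for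
  \<open>b = 0\<close> (MaxRAB) and new pairs for \<open>b = 1\<close> (MinRAB).\<close>

definition Costs :: "nat \<Rightarrow> prog" where
  "Costs b = For a_y a_n (For a_x a_n
     (Write a_cost (Cell (Var a_y) (Var a_x))
       (Add (Add (Sub (Const b) Pair_Bit) (Sub Pair_Bit (Const b)))
         (Read a_forb (Cell (Var a_y) (Var a_x))))))"

definition Output :: prog where
  "Output = For a_x a_n (Write a_out (Pos (Inc (Var a_k)) (Var a_x)) (Read a_f (Var a_x)))"

definition Extend :: "nat \<Rightarrow> prog" where
  "Extend b = Seq Load (Seq (Costs b) (Seq Match Output))"

text \<open>Uniqueness of division with remainder, after shifting the offsets from
  \<open>{1..n}\<close> to remainders below \<open>n\<close>.\<close>

lemma cell_eq_iff:
  fixes x x' n :: nat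
  assumes "x \<in> {1..n}" "x' \<in> {1..n}"
  shows "j * n + x = j' * n + x' \<longleftrightarrow> j = j' \<and> x = x'"
proof
  assume eq: "j * n + x = j' * n + x'"
  define y y' where "y = x - 1" and "y' = x' - 1"
  then have y: "x = Suc y" "x' = Suc y'" "y < n" "y' < n" using assms by auto
  then have "j * n + y = j' * n + y'" using eq by simp
  moreover have "(j * n + y) div n = j" "(j' * n + y') div n = j'" using y by auto
  ultimately have "j = j'" by metis
  then show "j = j' \<and> x = x'" using eq by simp
qed simp

definition pos :: "nat \<Rightarrow> nat \<Rightarrow> nat \<Rightarrow> nat" where
  "pos n i j = (i - 1) * n + (j - 1)"

lemma pos_eq_iff:
  assumes "j \<in> {1..n}" "j' \<in> {1..n}" "1 \<le> i" "1 \<le> i'"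
  shows "pos n i j = pos n i' j' \<longleftrightarrow> i = i' \<and> j = j'"
proof
  assume "pos n i j = pos n i' j'"
  then have "(i - 1) * n + j = (i' - 1) * n + j'" using assms by (auto simp: pos_def)
  then show "i = i' \<and> j = j'" using cell_eq_iff[OF assms(1,2)] assms by auto
qed simp

lemma store_pos:
  assumes "i \<in> {1..m}" "j \<in> {1..n}"
  shows "store m n A (pos n i j) = A i j"
proof -
  obtain y where y: "j = Suc y" "y < n" using assms by (cases j) auto
  then have "pos n i j div n = i - 1" "pos n i j mod n = j - 1" by (simp_all add: pos_def)
  moreover have "pos n i j < m * n"
  proof -
    have "pos n i j < (i - 1) * n + n" using assms by (auto simp: pos_def)
    also have "\<dots> = i * n" using assms by (cases i) auto
    also have "\<dots> \<le> m * n" using assms by (intro mult_right_mono) auto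
    finally show ?thesis .
  qed
  ultimately show ?thesis using assms by (simp add: store_def)
qed

text \<open>\<open>D\<close> is the set of positions processed so far, so one predicate serves as
  invariant of both loops of \<open>Load\<close> and as their result.\<close>

definition loaded :: "nat \<Rightarrow> array \<Rightarrow> array \<Rightarrow> (nat \<times> nat) set \<Rightarrow> state \<Rightarrow> bool" where
  "loaded n A B D s \<longleftrightarrow>
     (\<forall>a\<in>{1..n}. \<forall>b\<in>{1..n}. s a_pair (a * n + b) = of_bool (\<exists>(i, j)\<in>D. A i j = a \<and> B i j = b)) \<and>
     (\<forall>j\<in>{1..n}. \<forall>x\<in>{1..n}. s a_forb (j * n + x) = (if \<exists>i. (i, j) \<in> D \<and> A i j = x then n + 1 else 0)) \<and>
     (\<forall>(i, j)\<in>D. s a_out (pos n i j) = A i j)"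

lemma loaded_insert:
  assumes L: "loaded n A B D s" and D: "D \<subseteq> {1..} \<times> {1..n}" and ij: "1 \<le> i" "j \<in> {1..n}"
    and A: "A i j \<in> {1..n}" and B: "B i j \<in> {1..n}"
    and s': "s' a_pair = (s a_pair)(A i j * n + B i j := 1)"
      "s' a_forb = (s a_forb)(j * n + A i j := n + 1)"
      "s' a_out = (s a_out)(pos n i j := A i j)"
  shows "loaded n A B (insert (i, j) D) s'"
  unfolding loaded_def
proof (intro conjI ballI)
  fix a b assume ab: "a \<in> {1..n}" "b \<in> {1..n}"
  then have "s a_pair (a * n + b) = of_bool (\<exists>(i, j)\<in>D. A i j = a \<and> B i j = b)"
    using L unfolding loaded_def by blast
  then show "s' a_pair (a * n + b) = of_bool (\<exists>(i, j)\<in>insert (i, j) D. A i j = a \<and> B i j = b)"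
    using cell_eq_iff[OF ab(2) B, of a "A i j"] by (auto simp: s')
next
  fix y x assume yx: "y \<in> {1..n}" "x \<in> {1..n}"
  then have "s a_forb (y * n + x) = (if \<exists>i. (i, y) \<in> D \<and> A i y = x then n + 1 else 0)"
    using L unfolding loaded_def by blast
  then show "s' a_forb (y * n + x) = (if \<exists>i'. (i', y) \<in> insert (i, j) D \<and> A i' y = x then n + 1 else 0)"
    using cell_eq_iff[OF yx(2) A, of y j] by (auto simp: s')
next
  fix p assume p: "p \<in> insert (i, j) D"
  show "case p of (i, j) \<Rightarrow> s' a_out (pos n i j) = A i j"
  proof (cases p)
    case (Pair i' j')
    have "1 \<le> i'" "j' \<in> {1..n}" using p Pair D ij by auto
    moreover have "s a_out (pos n i' j') = A i' j'" if "(i', j') \<in> D"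
      using L that unfolding loaded_def by auto
    ultimately show ?thesis using p Pair pos_eq_iff[of j' n j i' i] ij by (auto simp: s')
  qed
qed

lemma runs_Load:
  assumes N: "n \<le> N" and M: "n + 2 \<le> M" and k: "k \<le> n"
    and s: "s a_n 0 = n" "s a_k 0 = k"
    and A: "\<And>i j. i \<in> {1..k} \<Longrightarrow> j \<in> {1..n} \<Longrightarrow> A i j \<in> {1..n} \<and> s a_A (pos n i j) = A i j"
    and B: "\<And>i j. i \<in> {1..k} \<Longrightarrow> j \<in> {1..n} \<Longrightarrow> B i j \<in> {1..n} \<and> s a_B (pos n i j) = B i j"
    and zero: "\<And>x. s a_pair x = 0" "\<And>x. s a_forb x = 0"
  shows "runs W M N Load s (loaded n A B ({1..k} \<times> {1..n}))"
  unfolding Load_def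
proof (rule runs_For[where m = k and I = "\<lambda>y. loaded n A B ({1..<y} \<times> {1..n})"], goal_cases)
  case 7
  then show ?case using zero by (simp add: loaded_def)
next
  case (8 y s')
  note outer = 8
  have fr: "s' a_n 0 = n" "s' a_k 0 = k" "s' a_A = s a_A" "s' a_B = s a_B" using 8(5) s by simp_all
  show ?case
  proof (rule runs_For[where m = n and
        I = "\<lambda>x. loaded n A B ({1..<y} \<times> {1..n} \<union> {y} \<times> {1..<x})"], goal_cases)
    case 7
    then show ?case using 8(3) by (simp add: loaded_def)
  next
    case (8 x t)
    have frt: "t a_n 0 = n" "t a_y 0 = y" "t a_A = s a_A" "t a_B = s a_B" using 8(5) fr outer by simp_all
    have yx: "y \<in> {1..k}" "x \<in> {1..n}" using 8 outer by auto
    have Dx: "{1..<y} \<times> {1..n} \<union> {y} \<times> {1..<Suc x} = insert (y, x) ({1..<y} \<times> {1..n} \<union> {y} \<times> {1..<x})"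
      using yx by auto
    have v: "val t' (Pos (Var a_y) (Var a_x)) = pos n y x" if "t' a_y 0 = y" "t' a_x 0 = x" "t' a_n 0 = n" for t'
      using that by (simp add: Pos_def pos_def)
    show ?case
      unfolding Dx
    proof (intro runs_Seq runs_Write, goal_cases)
      case 4
      show ?case
        by (rule loaded_insert[OF 8(3)]) (use yx 8(2) A[OF yx] B[OF yx] frt 8(4) v in auto)
    qed (use A[OF yx] B[OF yx] frt 8(4) v M in \<open>auto\<close>)
  next
    case (9 t)
    have "{1..<Suc y} \<times> {1..n} = {1..<y} \<times> {1..n} \<union> {y} \<times> {1..<Suc n}" using outer(1) by auto
    then show ?case using 9(1) by (simp add: loaded_def)
  qed (use fr N M in auto)
next
  case (9 s')
  have "{1..<Suc k} = {1..k}" by auto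
  then show ?case using 9(1) by simp
qed (use s N M k in auto)

lemma runs_Costs:
  assumes N: "n \<le> N" and M: "n + 2 \<le> M" and b: "b \<le> 1"
    and s: "s a_n 0 = n" "s a_k 0 = k"
    and B: "\<And>j. j \<in> {1..n} \<Longrightarrow> B (Suc k) j \<in> {1..n} \<and> s a_B (pos n (Suc k) j) = B (Suc k) j"
    and L: "loaded n A B D s"
  shows "runs W M N (Costs b) s (\<lambda>s'. \<forall>j\<in>{1..n}. \<forall>x\<in>{1..n}. s' a_cost (j * n + x) =
     of_bool ((\<exists>(i, j')\<in>D. A i j' = x \<and> B i j' = B (Suc k) j) \<noteq> (b = 1)) +
     (if \<exists>i. (i, j) \<in> D \<and> A i j = x then n + 1 else 0))"
proof -
  define c where "c j x = of_bool ((\<exists>(i, j')\<in>D. A i j' = x \<and> B i j' = B (Suc k) j) \<noteq> (b = 1)) +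
     (if \<exists>i. (i, j) \<in> D \<and> A i j = x then n + 1 else 0)" for j x
  let ?I = "\<lambda>E s'. \<forall>(j, x)\<in>E. s' a_cost (j * n + x) = c j x"
  have "runs W M N (Costs b) s (?I ({1..n} \<times> {1..n}))"
    unfolding Costs_def
  proof (rule runs_For[where m = n and I = "\<lambda>y. ?I ({1..<y} \<times> {1..n})"], goal_cases)
    case (8 y s')
    note outer = 8
    have fr: "s' a_n 0 = n" "s' a_k 0 = k" "s' a_B = s a_B" "s' a_pair = s a_pair" "s' a_forb = s a_forb"
      using 8(5) s by simp_all
    show ?case
    proof (rule runs_For[where m = n and I = "\<lambda>x. ?I ({1..<y} \<times> {1..n} \<union> {y} \<times> {1..<x})"], goal_cases)
      case 7
      then show ?case using 8(3) by simp
    next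
      case (8 x t)
      have frt: "t a_n 0 = n" "t a_k 0 = k" "t a_y 0 = y" "t a_x 0 = x" "t a_B = s a_B"
        "t a_pair = s a_pair" "t a_forb = s a_forb"
        using 8(4,5) fr outer by simp_all
      have y: "y \<in> {1..n}" and x: "x \<in> {1..n}" using 8 outer by auto
      have bit: "val t Pair_Bit = of_bool (\<exists>(i, j')\<in>D. A i j' = x \<and> B i j' = B (Suc k) y)"
        using L x B[OF y] frt unfolding loaded_def Pair_Bit_def by (simp add: Pos_def pos_def)
      have forb: "t a_forb (y * n + x) = (if \<exists>i. (i, y) \<in> D \<and> A i y = x then n + 1 else 0)"
        using L x y frt unfolding loaded_def by simp
      have Dx: "{1..<y} \<times> {1..n} \<union> {y} \<times> {1..<Suc x} = insert (y, x) ({1..<y} \<times> {1..n} \<union> {y} \<times> {1..<x})"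
        using x by auto
      \<comment> \<open>For \<open>b\<close> and the bit in \<open>{0, 1}\<close> at most one of the
        two truncated differences is nonzero, so their sum is the absolute difference.\<close>
      have val: "val t (Add (Add (Sub (Const b) Pair_Bit) (Sub Pair_Bit (Const b)))
          (Read a_forb (Cell (Var a_y) (Var a_x)))) = c y x"
        using b bit forb frt by (cases "b = 0") (auto simp: c_def)
      show ?case
        unfolding Dx
      proof (rule runs_Write, goal_cases)
        case 1
        \<comment> \<open>A unit cost on top of the penalty \<open>n + 1\<close> is what requires
          cells up to \<open>n + 2\<close>.\<close>
        have "c y x \<le> n + 2" by (simp add: c_def)
        then show ?case unfolding val using M by simp
      next
        case 2
        have "t a_cost (j * n + x') = c j x'" if "(j, x') \<in> {1..<y} \<times> {1..n} \<union> {y} \<times> {1..<x}" for j x'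
          using 8(3) that by blast
        moreover have "j * n + x' \<noteq> y * n + x" if "(j, x') \<in> {1..<y} \<times> {1..n} \<union> {y} \<times> {1..<x}" for j x'
        proof -
          have "x' \<in> {1..n}" using that x by auto
          from cell_eq_iff[OF this x] show ?thesis using that by auto
        qed
        ultimately show ?case unfolding val using frt by auto
      qed
    next
      case (9 t)
      have "{1..<Suc y} \<times> {1..n} = {1..<y} \<times> {1..n} \<union> {y} \<times> {1..<Suc n}" using outer(1) by auto
      then show ?case using 9(1) by simp
    qed (use fr N M in \<open>auto simp: Pair_Bit_def\<close>)
  next
    case (9 s')
    have "{1..<Suc n} = {1..n}" by auto
    then show ?case using 9(1) by simp
  qed (use s N M in auto)
  then show ?thesis by (rule runs_mono) (auto simp: c_def)
qed

lemma runs_Output: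
  assumes N: "n \<le> N" and M: "n + 2 \<le> M" and s: "s a_n 0 = n" "s a_k 0 = k"
    and f: "\<And>j. j \<in> {1..n} \<Longrightarrow> s a_f j \<le> n"
    and A: "\<And>i j. i \<in> {1..k} \<Longrightarrow> j \<in> {1..n} \<Longrightarrow> s a_out (pos n i j) = A i j"
  shows "runs W M N Output s (\<lambda>s'. (\<forall>j\<in>{1..n}. s' a_out (pos n (Suc k) j) = s a_f j) \<and>
    (\<forall>i\<in>{1..k}. \<forall>j\<in>{1..n}. s' a_out (pos n i j) = A i j))"
  unfolding Output_def
proof (rule runs_For[where m = n and I = "\<lambda>x s'.
      (\<forall>j\<in>{1..<x}. s' a_out (pos n (Suc k) j) = s a_f j) \<and>
      (\<forall>i\<in>{1..k}. \<forall>j\<in>{1..n}. s' a_out (pos n i j) = A i j)"], goal_cases)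
  case (8 x t)
  have fr: "t a_n 0 = n" "t a_k 0 = k" "t a_f = s a_f" "t a_x 0 = x" using 8(4,5) s by simp_all
  have x: "x \<in> {1..n}" using 8 by auto
  have v: "val t (Pos (Inc (Var a_k)) (Var a_x)) = pos n (Suc k) x"
    using fr by (simp add: Pos_def pos_def)
  show ?case
  proof (rule runs_Write, goal_cases)
    case 1
    then show ?case using fr f[OF x] M by simp
  next
    case 2
    have "pos n i j \<noteq> pos n (Suc k) x" if "i \<in> {1..k}" "j \<in> {1..n}" for i j
      using pos_eq_iff[of j n x i "Suc k"] that x by auto
    moreover have "pos n (Suc k) j \<noteq> pos n (Suc k) x" if "j \<in> {1..<x}" for j
      using pos_eq_iff[of j n x "Suc k" "Suc k"] that x by auto
    ultimately show ?case unfolding v using 8(3) fr by (auto simp: less_Suc_eq)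
  qed
qed (use s N M A in auto)


section \<open>Extensions as assignments\<close>

lemma latin_rectangleD:
  assumes "latin_rectangle k n A"
  shows "k \<le> n" "\<And>i j. i \<in> {1..k} \<Longrightarrow> j \<in> {1..n} \<Longrightarrow> A i j \<in> {1..n}"
    and "\<And>i. i \<in> {1..k} \<Longrightarrow> inj_on (A i) {1..n}"
    and "\<And>j. j \<in> {1..n} \<Longrightarrow> inj_on (\<lambda>i. A i j) {1..k}"
    and "\<And>i. i \<in> {1..k} \<Longrightarrow> bij_betw (A i) {1..n} {1..n}"
proof -
  show "bij_betw (A i) {1..n} {1..n}" if "i \<in> {1..k}" for i
    using assms that unfolding latin_rectangle_def
    by (intro bij_betw_imageI endo_inj_surj) auto
qed (use assms in \<open>auto simp: latin_rectangle_def\<close>)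

lemma card_free_symbols:
  assumes A: "latin_rectangle k n A" and j: "j \<in> {1..n}"
  shows "card {x\<in>{1..n}. \<forall>i\<in>{1..k}. A i j \<noteq> x} = n - k"
proof -
  have "{x\<in>{1..n}. \<forall>i\<in>{1..k}. A i j \<noteq> x} = {1..n} - (\<lambda>i. A i j) ` {1..k}" by auto
  moreover have "card ((\<lambda>i. A i j) ` {1..k}) = k"
    using card_image[OF latin_rectangleD(4)[OF A j]] by simp
  moreover have "(\<lambda>i. A i j) ` {1..k} \<subseteq> {1..n}" using latin_rectangleD(2)[OF A _ j] by blast
  ultimately show ?thesis by (simp add: card_Diff_subset)
qed

text \<open>Each of the \<open>k\<close> rows is a permutation and contains \<open>x\<close> exactly
  once, at column \<open>p i\<close>; these columns are distinct because no column repeats a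
  symbol.\<close>

lemma card_free_columns:
  assumes A: "latin_rectangle k n A" and x: "x \<in> {1..n}"
  shows "card {j\<in>{1..n}. \<forall>i\<in>{1..k}. A i j \<noteq> x} = n - k"
proof -
  define p where "p i = inv_into {1..n} (A i) x" for i
  have p: "p i \<in> {1..n}" "A i (p i) = x" if "i \<in> {1..k}" for i
  proof -
    have "x \<in> A i ` {1..n}" using latin_rectangleD(5)[OF A that] x unfolding bij_betw_def by simp
    then show "p i \<in> {1..n}" "A i (p i) = x"
      unfolding p_def by (auto simp only: inv_into_into f_inv_into_f)
  qed
  have "j \<in> p ` {1..k}" if "j \<in> {1..n}" "i \<in> {1..k}" "A i j = x" for i j
  proof -
    have "j = p i" using latin_rectangleD(3)[OF A that(2)] p[OF that(2)] that by (auto dest: inj_onD)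
    then show ?thesis using that by blast
  qed
  then have "{j\<in>{1..n}. \<forall>i\<in>{1..k}. A i j \<noteq> x} = {1..n} - p ` {1..k}" using p by fastforce
  moreover have "inj_on p {1..k}"
  proof (rule inj_onI)
    fix i i' assume i: "i \<in> {1..k}" "i' \<in> {1..k}" "p i = p i'"
    then have "A i (p i) = A i' (p i)" using p(2)[OF i(1)] p(2)[OF i(2)] by simp
    then show "i = i'" using latin_rectangleD(4)[OF A p(1)[OF i(1)]] i by (auto dest: inj_onD)
  qed
  moreover have "p ` {1..k} \<subseteq> {1..n}" using p by blast
  ultimately show ?thesis by (simp add: card_Diff_subset card_image)
qed

text \<open>Column \<open>j\<close> and symbol \<open>x\<close> are compatible if \<open>x\<close> does not occur in column \<open>j\<close>. This bipartite
  graph is regular of degree \<open>n - k\<close>; summing the dual constraints over its edges bounds every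
  feasible dual solution.\<close>

lemma dual_bound:
  assumes A: "latin_rectangle k n A" and k: "k < n"
    and c: "\<And>j x. j \<in> {1..n} \<Longrightarrow> x \<in> {1..n} \<Longrightarrow> \<forall>i\<in>{1..k}. A i j \<noteq> x \<Longrightarrow> c j x \<le> 1"
    and F: "feasible n c u w"
  shows "sum u {1..n} \<le> sum w {1..n} + n"
proof -
  let ?E = "\<lambda>j. {x\<in>{1..n}. \<forall>i\<in>{1..k}. A i j \<noteq> x}"
  have "(n - k) * sum u {1..n} = (\<Sum>j\<in>{1..n}. \<Sum>x\<in>?E j. u j)"
    using card_free_symbols[OF A] by (simp add: sum_distrib_left)
  also have "\<dots> \<le> (\<Sum>j\<in>{1..n}. \<Sum>x\<in>?E j. 1 + w x)"
  proof (intro sum_mono)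
    fix j x assume j: "j \<in> {1..n}" and x: "x \<in> ?E j"
    then have "u j \<le> c j x + w x" using F unfolding feasible_def by blast
    moreover have "c j x \<le> 1" using c[of j x] j x by blast
    ultimately show "u j \<le> 1 + w x" by linarith
  qed
  also have "\<dots> = n * (n - k) + (\<Sum>j\<in>{1..n}. \<Sum>x\<in>?E j. w x)"
    unfolding sum.distrib using card_free_symbols[OF A] by simp
  also have "(\<Sum>j\<in>{1..n}. \<Sum>x\<in>?E j. w x) = (\<Sum>x\<in>{1..n}. \<Sum>j\<in>{j\<in>{1..n}. \<forall>i\<in>{1..k}. A i j \<noteq> x}. w x)"
    by (rule sum.swap_restrict) simp_all
  also have "\<dots> = (n - k) * sum w {1..n}"
    using card_free_columns[OF A] by (simp add: sum_distrib_left)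
  finally have "(n - k) * sum u {1..n} \<le> (n - k) * (sum w {1..n} + n)" by (simp add: algebra_simps)
  then show ?thesis using k by simp
qed

section \<open>Duality for the assignment problem\<close>

lemma perfect_matching_bij:
  assumes P: "partial_matching n c u w (Suc n) f g"
  shows "bij_betw f {1..n} {1..n}"
proof -
  have "inj_on f {1..n}"
    using partial_matchingD(2)[OF P] by (intro inj_on_inverseI[of _ g]) (auto simp: less_Suc_eq_le)
  moreover have "f ` {1..n} \<subseteq> {1..n}" using partial_matchingD(1)[OF P] by (auto simp: less_Suc_eq_le)
  ultimately show ?thesis by (intro bij_betw_imageI endo_inj_surj) auto
qed

text \<open>Complementary slackness: all matched edges are tight, so the cost equals the dual
  objective.\<close>

lemma perfect_matching_cost:
  assumes P: "partial_matching n c u w (Suc n) f g"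
  shows "(\<Sum>j\<in>{1..n}. c j (f j)) + sum w {1..n} = sum u {1..n}"
proof -
  have "sum u {1..n} = (\<Sum>j\<in>{1..n}. c j (f j) + w (f j))"
    using partial_matchingD(3)[OF P] by (intro sum.cong) (auto simp: less_Suc_eq_le)
  also have "\<dots> = (\<Sum>j\<in>{1..n}. c j (f j)) + sum w {1..n}"
    using sum.reindex_bij_betw[OF perfect_matching_bij[OF P], of w] by (simp add: sum.distrib)
  finally show ?thesis by simp
qed

text \<open>Weak duality.\<close>

lemma feasible_cost:
  assumes F: "feasible n c u w" and h: "bij_betw h {1..n} {1..n}"
  shows "sum u {1..n} \<le> (\<Sum>j\<in>{1..n}. c j (h j)) + sum w {1..n}"
proof -
  have "sum u {1..n} \<le> (\<Sum>j\<in>{1..n}. c j (h j) + w (h j))"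
    using F bij_betwE[OF h] unfolding feasible_def by (intro sum_mono) blast
  then show ?thesis using sum.reindex_bij_betw[OF h, of w] by (simp add: sum.distrib)
qed

lemma extension_bij:
  assumes "extension k n A C"
  shows "bij_betw (C (Suc k)) {1..n} {1..n}"
  using assms latin_rectangleD(5)[of "Suc k" n C "Suc k"] by (simp add: extension_def)

section \<open>From the number of distinct pairs to assignment costs\<close>

definition pairs :: "nat \<Rightarrow> nat \<Rightarrow> array \<Rightarrow> array \<Rightarrow> (nat \<times> nat) set" where
  "pairs k n A B = {(A i j, B i j) | i j. i \<in> {1..k} \<and> j \<in> {1..n}}"

text \<open>Pairs of the new row differ in their first components, so each column whose pair is not
  old contributes exactly one.\<close>

lemma r_extension:
  fixes B :: array
  assumes C: "extension k n A C"
  defines "P \<equiv> pairs k n A B"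
  shows "r (k + 1) n C B = card P + card {j\<in>{1..n}. (C (Suc k) j, B (Suc k) j) \<notin> P}"
proof -
  let ?J = "{j\<in>{1..n}. (C (Suc k) j, B (Suc k) j) \<notin> P}"
  let ?h = "\<lambda>j. (C (Suc k) j, B (Suc k) j)"
  have eq: "C i j = A i j" if "i \<in> {1..k}" "j \<in> {1..n}" for i j
    using C that unfolding extension_def by blast
  have "{(C i j, B i j) | i j. i \<in> {1..k + 1} \<and> j \<in> {1..n}} = P \<union> ?h ` ?J"
  proof (intro equalityI subsetI)
    fix p assume "p \<in> {(C i j, B i j) | i j. i \<in> {1..k + 1} \<and> j \<in> {1..n}}"
    then obtain i j where ij: "p = (C i j, B i j)" "i \<in> {1..k + 1}" "j \<in> {1..n}" by blast
    show "p \<in> P \<union> ?h ` ?J"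
    proof (cases "i = Suc k")
      case True
      then show ?thesis using ij by (cases "p \<in> P") simp_all
    next
      case False
      then have "i \<in> {1..k}" using ij by auto
      then have "p = (A i j, B i j)" using ij(1) eq[OF _ ij(3)] by simp
      then show ?thesis using \<open>i \<in> {1..k}\<close> ij(3) unfolding P_def pairs_def by blast
    qed
  next
    fix p assume "p \<in> P \<union> ?h ` ?J"
    then show "p \<in> {(C i j, B i j) | i j. i \<in> {1..k + 1} \<and> j \<in> {1..n}}"
    proof
      assume "p \<in> P"
      then obtain i j where "p = (A i j, B i j)" "i \<in> {1..k}" "j \<in> {1..n}" unfolding P_def pairs_def by blast
      then have "p = (C i j, B i j)" "i \<in> {1..k + 1}" "j \<in> {1..n}" using eq[of i j] by simp_all
      then show ?thesis by blast
    next
      assume "p \<in> ?h ` ?J"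
      then obtain j where "p = (C (Suc k) j, B (Suc k) j)" "j \<in> {1..n}" by blast
      moreover have "Suc k \<in> {1..k + 1}" by simp
      ultimately show ?thesis by blast
    qed
  qed
  moreover have "finite P"
  proof -
    have "P \<subseteq> (\<lambda>(i, j). (A i j, B i j)) ` ({1..k} \<times> {1..n})" unfolding P_def pairs_def by auto
    then show ?thesis by (rule finite_subset) simp
  qed
  moreover have "P \<inter> ?h ` ?J = {}" by blast
  moreover have "card (?h ` ?J) = card ?J"
  proof (rule card_image, rule inj_onI)
    fix j j' assume "j \<in> ?J" "j' \<in> ?J" "?h j = ?h j'"
    then show "j = j'" using inj_onD[OF bij_betw_imp_inj_on[OF extension_bij[OF C]], of j j'] by simp
  qed
  ultimately show ?thesis unfolding r_def by (simp add: card_Un_disjoint)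
qed

text \<open>The shape repeats the postcondition of \<open>runs_Costs\<close> with
  \<open>D = {1..k} \<times> {1..n}\<close>, so that unfolding makes them agree.\<close>

definition extension_cost ::
  "nat \<Rightarrow> nat \<Rightarrow> array \<Rightarrow> array \<Rightarrow> nat \<Rightarrow> nat \<Rightarrow> nat \<Rightarrow> nat" where
  "extension_cost k n A B b j x =
     of_bool ((\<exists>(i, j')\<in>{1..k} \<times> {1..n}. A i j' = x \<and> B i j' = B (Suc k) j) \<noteq> (b = 1)) +
     (if \<exists>i. (i, j) \<in> {1..k} \<times> {1..n} \<and> A i j = x then n + 1 else 0)"

text \<open>A genuine extension never pays the penalty, so only old pairs are counted, or only new
  pairs if \<open>b = 1\<close>.\<close>

lemma extension_cost_sum:
  fixes B :: array
  assumes C: "extension k n A C"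
  defines "P \<equiv> pairs k n A B"
  shows "(\<Sum>j\<in>{1..n}. extension_cost k n A B b j (C (Suc k) j)) =
    card {j\<in>{1..n}. ((C (Suc k) j, B (Suc k) j) \<in> P) \<noteq> (b = 1)}"
proof -
  have "extension_cost k n A B b j (C (Suc k) j) = of_bool (((C (Suc k) j, B (Suc k) j) \<in> P) \<noteq> (b = 1))"
    if j: "j \<in> {1..n}" for j
  proof -
    have L: "latin_rectangle (Suc k) n C" using C by (simp add: extension_def)
    have ne: "A i j \<noteq> C (Suc k) j" if "i \<in> {1..k}" for i
    proof
      assume "A i j = C (Suc k) j"
      then have "C i j = C (Suc k) j" using C that j unfolding extension_def by simp
      then have "i = Suc k"
        using inj_onD[OF latin_rectangleD(4)[OF L j], of i "Suc k"] that by simp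
      then show False using that by simp
    qed
    have old: "(\<exists>(i, j')\<in>{1..k} \<times> {1..n}. A i j' = x \<and> B i j' = y) \<longleftrightarrow> (x, y) \<in> P" for x y
      unfolding P_def pairs_def by blast
    have "\<not> (\<exists>i. (i, j) \<in> {1..k} \<times> {1..n} \<and> A i j = C (Suc k) j)" using ne by blast
    then show ?thesis unfolding extension_cost_def old by simp
  qed
  then have "(\<Sum>j\<in>{1..n}. extension_cost k n A B b j (C (Suc k) j)) =
      (\<Sum>j\<in>{1..n}. of_bool (((C (Suc k) j, B (Suc k) j) \<in> P) \<noteq> (b = 1)))"
    by (intro sum.cong) auto
  also have "\<dots> = card {j\<in>{1..n}. ((C (Suc k) j, B (Suc k) j) \<in> P) \<noteq> (b = 1)}"
    by (simp add: of_bool_def sum.If_cases Int_def)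
  finally show ?thesis .
qed

text \<open>Tightness and the dual bound keep the matching away from penalties, so it yields a Latin
  rectangle; optimality is weak duality against the last row of \<open>C\<close>.\<close>

lemma optimal_extension:
  assumes A: "latin_rectangle k n A" and k: "k < n"
    and c: "\<And>j x. j \<in> {1..n} \<Longrightarrow> x \<in> {1..n} \<Longrightarrow> c j x = extension_cost k n A B b j x"
    and F: "feasible n c u w" and P: "partial_matching n c u w (Suc n) f g"
    and X: "\<And>j. j \<in> {1..n} \<Longrightarrow> X (Suc k) j = f j"
      "\<And>i j. i \<in> {1..k} \<Longrightarrow> j \<in> {1..n} \<Longrightarrow> X i j = A i j"
  shows "extension k n A X"
    and "extension k n A C \<Longrightarrow> (\<Sum>j\<in>{1..n}. extension_cost k n A B b j (X (Suc k) j)) \<le>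
      (\<Sum>j\<in>{1..n}. extension_cost k n A B b j (C (Suc k) j))"
proof -
  note f = perfect_matching_bij[OF P]
  have f1: "f j \<in> {1..n}" if "j \<in> {1..n}" for j using bij_betwE[OF f] that by blast
  have "c j x \<le> 1" if "j \<in> {1..n}" "x \<in> {1..n}" "\<forall>i\<in>{1..k}. A i j \<noteq> x" for j x
    using c[OF that(1,2)] that(3) by (auto simp: extension_cost_def)
  then have "sum u {1..n} \<le> sum w {1..n} + n" by (rule dual_bound[OF A k _ F])
  then have cost: "(\<Sum>j\<in>{1..n}. c j (f j)) \<le> n"
    using perfect_matching_cost[OF P] by linarith
  \<comment> \<open>One forbidden cell alone would cost \<open>n + 1\<close>, more than the whole
    matching.\<close>
  have free: "A i j \<noteq> f j" if "i \<in> {1..k}" "j \<in> {1..n}" for i j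
  proof
    assume "A i j = f j"
    then have "n + 1 \<le> c j (f j)"
      using c[OF that(2) f1[OF that(2)]] that by (auto simp: extension_cost_def)
    also have "\<dots> \<le> (\<Sum>j\<in>{1..n}. c j (f j))" using that by (intro member_le_sum) auto
    finally show False using cost by simp
  qed
  have "latin_rectangle (Suc k) n X"
    unfolding latin_rectangle_def
  proof (intro conjI ballI)
    show "Suc k \<le> n" using k by simp
    fix i assume i: "i \<in> {1..Suc k}"
    show "X i j \<in> {1..n}" if "j \<in> {1..n}" for j
      using i that X f1 latin_rectangleD(2)[OF A, of i j] by (cases "i = Suc k") auto
    have "inj_on (X i) {1..n}"
    proof (cases "i = Suc k")
      case True
      then show ?thesis using f X(1) inj_on_cong[of "{1..n}" "X i" f] by (auto simp: bij_betw_def)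
    next
      case False
      then have i: "i \<in> {1..k}" using i by auto
      then show ?thesis
        using latin_rectangleD(3)[OF A i] X(2) inj_on_cong[of "{1..n}" "X i" "A i"] by auto
    qed
    then show "inj_on (\<lambda>j. X i j) {1..n}" by simp
  next
    fix j assume j: "j \<in> {1..n}"
    have "{1..Suc k} = insert (Suc k) {1..k}" by auto
    moreover have "inj_on (\<lambda>i. X i j) {1..k}"
      using latin_rectangleD(4)[OF A j] X(2) j inj_on_cong[of "{1..k}" "\<lambda>i. X i j" "\<lambda>i. A i j"] by auto
    moreover have "X (Suc k) j \<notin> (\<lambda>i. X i j) ` {1..k}"
    proof
      assume "X (Suc k) j \<in> (\<lambda>i. X i j) ` {1..k}"
      then obtain i where "i \<in> {1..k}" "X i j = X (Suc k) j" by auto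
      then show False using X(1)[OF j] X(2)[OF _ j, of i] free[OF _ j, of i] by simp
    qed
    ultimately show "inj_on (\<lambda>i. X i j) {1..Suc k}" by simp
  qed
  then show "extension k n A X" using X(2) by (simp add: extension_def)
  assume C: "extension k n A C"
  note h = extension_bij[OF C]
  have "(\<Sum>j\<in>{1..n}. c j (f j)) \<le> (\<Sum>j\<in>{1..n}. c j (C (Suc k) j))"
    using perfect_matching_cost[OF P] feasible_cost[OF F h] by linarith
  moreover have "(\<Sum>j\<in>{1..n}. c j (f j)) = (\<Sum>j\<in>{1..n}. extension_cost k n A B b j (X (Suc k) j))"
    using c f1 X(1) by (intro sum.cong) auto
  moreover have "(\<Sum>j\<in>{1..n}. c j (C (Suc k) j)) = (\<Sum>j\<in>{1..n}. extension_cost k n A B b j (C (Suc k) j))"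
    using c bij_betwE[OF h] by (intro sum.cong) auto
  ultimately show "(\<Sum>j\<in>{1..n}. extension_cost k n A B b j (X (Suc k) j)) \<le>
      (\<Sum>j\<in>{1..n}. extension_cost k n A B b j (C (Suc k) j))" by simp
qed

lemma card_not_eq_diff: "card {j\<in>{1..n}. Q j} = n - card {j\<in>{1..n::nat}. \<not> Q j}" and
  card_not_le: "card {j\<in>{1..n::nat}. \<not> Q j} \<le> n"
proof -
  have "{j\<in>{1..n}. Q j} = {1..n} - {j\<in>{1..n}. \<not> Q j}" by auto
  moreover have "card ({1..n} - {j\<in>{1..n}. \<not> Q j}) = card {1..n} - card {j\<in>{1..n}. \<not> Q j}"
    by (rule card_Diff_subset) auto
  ultimately show "card {j\<in>{1..n}. Q j} = n - card {j\<in>{1..n}. \<not> Q j}" by simp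
  show "card {j\<in>{1..n::nat}. \<not> Q j} \<le> n"
  proof -
    have "{j\<in>{1..n}. \<not> Q j} \<subseteq> {1..n}" by blast
    from card_mono[OF _ this] show ?thesis by simp
  qed
qed

text \<open>For \<open>b = 0\<close> the cost counts old pairs, while \<open>r\<close> grows with
  the new ones; the two counts add up to \<open>n\<close>.\<close>

lemma MaxRAB_I:
  assumes X: "extension k n A X"
    and opt: "\<And>C. extension k n A C \<Longrightarrow> (\<Sum>j\<in>{1..n}. extension_cost k n A B 0 j (X (Suc k) j)) \<le>
      (\<Sum>j\<in>{1..n}. extension_cost k n A B 0 j (C (Suc k) j))"
  shows "MaxRAB k n A B X"
  unfolding MaxRAB_def
proof (intro conjI allI impI X)
  fix C assume C: "extension k n A C"
  let ?old = "\<lambda>Y j. (Y (Suc k) j, B (Suc k) j) \<in> pairs k n A B"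
  have "card {j\<in>{1..n}. ?old X j} \<le> card {j\<in>{1..n}. ?old C j}"
    using opt[OF C] unfolding extension_cost_sum[OF X] extension_cost_sum[OF C] by simp
  then have "card {j\<in>{1..n}. \<not> ?old C j} \<le> card {j\<in>{1..n}. \<not> ?old X j}"
    using card_not_eq_diff[of n "?old X"] card_not_eq_diff[of n "?old C"]
      card_not_le[of n "?old X"] card_not_le[of n "?old C"] by linarith
  then show "r (k + 1) n C B \<le> r (k + 1) n X B"
    unfolding r_extension[OF X] r_extension[OF C] by simp
qed

text \<open>For \<open>b = 1\<close> the cost counts new pairs, which is \<open>r\<close> up to a
  constant.\<close>

lemma MinRAB_I:
  assumes X: "extension k n A X"
    and opt: "\<And>C. extension k n A C \<Longrightarrow> (\<Sum>j\<in>{1..n}. extension_cost k n A B 1 j (X (Suc k) j)) \<le>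
      (\<Sum>j\<in>{1..n}. extension_cost k n A B 1 j (C (Suc k) j))"
  shows "MinRAB k n A B X"
  unfolding MinRAB_def
proof (intro conjI allI impI X)
  fix C assume C: "extension k n A C"
  show "r (k + 1) n X B \<le> r (k + 1) n C B"
    using opt[OF C]
    unfolding r_extension[OF X] r_extension[OF C] extension_cost_sum[OF X] extension_cost_sum[OF C]
    by simp
qed

section \<open>The complete algorithm and its running time\<close>

lemma runs_Extend:
  assumes A: "latin_rectangle k n A" and B: "latin_rectangle (k + 1) n B" and k: "k < n" "1 \<le> k"
    and b: "b \<le> 1" and N: "2 * n \<le> N" and M: "n + 2 \<le> M"
  shows "runs W M N (Extend b) (initial n k A B) (\<lambda>s. extension k n A (final n s) \<and>
    (\<forall>C. extension k n A C \<longrightarrow>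
      (\<Sum>j\<in>{1..n}. extension_cost k n A B b j (final n s (Suc k) j)) \<le>
      (\<Sum>j\<in>{1..n}. extension_cost k n A B b j (C (Suc k) j))))"
proof -
  define s0 where "s0 = initial n k A B"
  have Nn: "n \<le> N" using N by simp
  have s0: "s0 a_n 0 = n" "s0 a_k 0 = k" "s0 a_A = store k n A" "s0 a_B = store (k + 1) n B"
    "\<And>a. 5 \<le> a \<Longrightarrow> s0 a = (\<lambda>_. 0)"
    by (auto simp: s0_def initial_def)
  have Av: "A i j \<in> {1..n} \<and> s0 a_A (pos n i j) = A i j" if "i \<in> {1..k}" "j \<in> {1..n}" for i j
    using latin_rectangleD(2)[OF A that] store_pos[OF that] s0 by simp
  have Bv: "B i j \<in> {1..n} \<and> s0 a_B (pos n i j) = B i j" if "i \<in> {1..k + 1}" "j \<in> {1..n}" for i j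
    using latin_rectangleD(2)[OF B that] store_pos[OF that] s0 by simp
  let ?D = "{1..k} \<times> {1..n}"
  have load: "runs W M N Load s0 (loaded n A B ?D)"
    by (rule runs_Load[OF Nn M]) (use k s0 Av Bv in auto)
  have wL: "writes Load = {a_y, a_x, a_pair, a_forb, a_out}" by (auto simp: Load_def)
  have wC: "writes (Costs b) = {a_y, a_x, a_cost}" by (auto simp: Costs_def)
  have "runs W M N (Extend b) s0 (\<lambda>s. extension k n A (final n s) \<and>
    (\<forall>C. extension k n A C \<longrightarrow>
      (\<Sum>j\<in>{1..n}. extension_cost k n A B b j (final n s (Suc k) j)) \<le>
      (\<Sum>j\<in>{1..n}. extension_cost k n A B b j (C (Suc k) j))))"
    unfolding Extend_def
  proof (rule runs_Seq, rule runs_mono[OF load], goal_cases)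
    case (1 s1)
    have s1: "s1 a_n 0 = n" "s1 a_k 0 = k" "s1 a_B = s0 a_B"
      using 1(1) s0 by (simp_all add: wL)
    have costs: "runs W M N (Costs b) s1 (\<lambda>s'. \<forall>j\<in>{1..n}. \<forall>x\<in>{1..n}.
        s' a_cost (j * n + x) = extension_cost k n A B b j x)"
      unfolding extension_cost_def
      by (rule runs_Costs[OF Nn M b _ _ _ 1(2)]) (use s1 Bv in auto)
    show ?case
    proof (rule runs_Seq, rule runs_mono[OF costs], goal_cases)
      case (1 s2)
      note cost = 1(2)
      define c where "c = table n (s2 a_cost)"
      have s2: "s2 a_n 0 = n" "s2 a_k 0 = k" "s2 a_out = s1 a_out"
        using 1(1) s1 by (simp_all add: wC)
      \<comment> \<open>\<open>Load\<close> and \<open>Costs\<close> do not write these arrays, so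
        the zeros of the initial state provide the empty matching and zero potentials.\<close>
      have zero: "s2 a = (\<lambda>_. 0)" if "a \<in> {a_u, a_w, a_f, a_g, a_vis}" for a
        using 1(1) \<open>\<And>a. a \<notin> writes Load \<Longrightarrow> s1 a = s0 a\<close> s0(5)[of a] that by (auto simp: wL wC)
      have c: "c j x = extension_cost k n A B b j x" if "j \<in> {1..n}" "x \<in> {1..n}" for j x
        using cost that by (simp add: c_def table_def)
      have c1: "c j x \<le> 1" if "j \<in> {1..n}" "x \<in> {1..n}" "\<forall>i\<in>{1..k}. A i j \<noteq> x" for j x
        using c[OF that(1,2)] that(3) by (auto simp: extension_cost_def)
      have match: "runs W M N Match s2 (\<lambda>s'. feasible n c (s' a_u) (s' a_w) \<and>
          partial_matching n c (s' a_u) (s' a_w) (Suc n) (s' a_f) (s' a_g))"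
        unfolding c_def
        by (rule runs_Match[OF N M]) (use dual_bound[OF A k(1) c1] s2 zero in \<open>auto simp: c_def\<close>)
      show ?case
      proof (rule runs_Seq, rule runs_mono[OF match], goal_cases)
        case (1 s3)
        then have F: "feasible n c (s3 a_u) (s3 a_w)"
          and P: "partial_matching n c (s3 a_u) (s3 a_w) (Suc n) (s3 a_f) (s3 a_g)" by auto
        have s3: "s3 a_n 0 = n" "s3 a_k 0 = k" "s3 a_out = s1 a_out" using 1(1) s2 by simp_all
        have out: "s3 a_out (pos n i j) = A i j" if "i \<in> {1..k}" "j \<in> {1..n}" for i j
          using \<open>loaded n A B ?D s1\<close> that unfolding loaded_def s3 by auto
        have f: "s3 a_f j \<le> n" if "j \<in> {1..n}" for j
          using bij_betwE[OF perfect_matching_bij[OF P]] that by auto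
        have outp: "runs W M N Output s3 (\<lambda>s'. (\<forall>j\<in>{1..n}. s' a_out (pos n (Suc k) j) = s3 a_f j) \<and>
            (\<forall>i\<in>{1..k}. \<forall>j\<in>{1..n}. s' a_out (pos n i j) = A i j))"
          by (rule runs_Output[OF Nn M s3(1,2) f out])
        show ?case
        proof (rule runs_mono[OF outp], goal_cases)
          case (1 s4)
          have X: "final n s4 (Suc k) j = s3 a_f j" if "j \<in> {1..n}" for j
            using 1(2) that by (simp add: final_def fetch_def pos_def)
          have X': "final n s4 i j = A i j" if "i \<in> {1..k}" "j \<in> {1..n}" for i j
            using 1(2) that by (simp add: final_def fetch_def pos_def)
          show ?case
            using optimal_extension[OF A k(1) c F P X X'] by blast
        qed
      qed
    qed
  qed
  then show ?thesis by (simp add: s0_def)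
qed

text \<open>The deepest nesting is rounds of \<open>Match\<close>, scans of \<open>Search\<close>,
  and symbols of \<open>Scan\<close>.\<close>

lemma loop_depth_Extend: "loop_depth (Extend b) = 3"
  by (simp add: Extend_def Load_def Costs_def Match_def Output_def Search_def Scan_def Augment_def
      Dual_Step_def For_def Assign_def)

lemma initial_bounded:
  assumes A: "latin_rectangle k n A" and B: "latin_rectangle (k + 1) n B" and k: "k < n"
  shows "bounded_by (n + 2) (initial n k A B)"
proof -
  have st: "store m n X x \<le> n + 2" if X: "latin_rectangle m n X" for m X x
  proof (cases "x < m * n")
    case True
    then have "x div n + 1 \<in> {1..m}" "x mod n + 1 \<in> {1..n}"
      using k by (auto simp: less_mult_imp_div_less Suc_le_eq)
    then show ?thesis using latin_rectangleD(2)[OF X] True unfolding store_def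
      by (metis atLeastAtMost_iff trans_le_add1)
  qed (simp add: store_def)
  show ?thesis using st[OF A] st[OF B] k by (auto simp: bounded_by_def initial_def)
qed

text \<open>The parameters are \<open>N = 2 * n\<close> iterations per loop, cells up to
  \<open>M = n + 2\<close>, and words below \<open>W = n ^ d\<close>.\<close>

lemma Extend_solves:
  assumes b: "b \<le> 1"
    and sol: "\<And>k n A B X. extension k n A X \<Longrightarrow>
      (\<And>C. extension k n A C \<Longrightarrow> (\<Sum>j\<in>{1..n}. extension_cost k n A B b j (X (Suc k) j)) \<le>
        (\<Sum>j\<in>{1..n}. extension_cost k n A B b j (C (Suc k) j))) \<Longrightarrow> sol k n A B X"
  shows "\<exists>p T. (\<lambda>n. real (T n)) \<in> O(\<lambda>n. real n ^ 3) \<and> solves_within p T sol"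
proof -
  let ?p = "Extend b" and ?T = "\<lambda>n. time_bound (2 * n) (Extend b)"
  obtain K where K: "\<And>N. time_bound N ?p \<le> K * (N + 1) ^ 3"
    using time_bound_polynomial[of ?p] unfolding loop_depth_Extend by blast
  have O: "(\<lambda>n. real (?T n)) \<in> O(\<lambda>n. real n ^ 3)"
  proof (rule bigoI[of _ "real (K * 27)"], rule eventually_sequentiallyI[of 1])
    fix n :: nat assume "1 \<le> n"
    \<comment> \<open>\<open>2 * n + 1 \<le> 3 * n\<close> for \<open>n \<ge> 1\<close>, whence the
      constant \<open>27\<close>.\<close>
    then have "(2 * n + 1) ^ 3 \<le> (3 * n) ^ 3" by (intro power_mono) auto
    then have "K * (2 * n + 1) ^ 3 \<le> K * (3 * n) ^ 3" by (rule mult_le_mono2)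
    with K[of "2 * n"] have "?T n \<le> K * (3 * n) ^ 3" by (rule order_trans)
    then have "?T n \<le> K * 27 * n ^ 3" by (simp add: power_mult_distrib)
    then have "real (?T n) \<le> real (K * 27 * n ^ 3)" by (simp only: of_nat_le_iff)
    then show "norm (real (?T n)) \<le> real (K * 27) * norm (real n ^ 3)" by simp
  qed
  obtain d where d: "\<And>n. n \<ge> 2 \<Longrightarrow> prog_bound (n + 2) ?p < n ^ d"
    using prog_bound_polynomial[of ?p] by blast
  have "solves_within ?p ?T sol"
    unfolding solves_within_def
  proof (rule exI[of _ d], intro allI impI)
    fix n k A B
    assume *: "1 \<le> k \<and> k < n \<and> latin_rectangle k n A \<and> latin_rectangle (k + 1) n B"
    then have "prog_bound (n + 2) ?p < n ^ d" by (intro d) auto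
    moreover have "bounded_by (n + 2) (initial n k A B)" using * initial_bounded by blast
    moreover have "runs (n ^ d) (n + 2) (2 * n) ?p (initial n k A B) (\<lambda>s. sol k n A B (final n s))"
      by (rule runs_mono[OF runs_Extend]) (use * b sol in auto)
    ultimately show "\<exists>t s. exec (n ^ d) ?p (initial n k A B) t s \<and> t \<le> ?T n \<and> sol k n A B (final n s)"
      unfolding runs_def by blast
  qed
  with O show ?thesis by (intro exI[of _ ?p] exI[of _ ?T] conjI)
qed

theorem theorem6:
  "(\<exists>p T. (\<lambda>n. real (T n)) \<in> O(\<lambda>n. real n ^ 3) \<and> solves_within p T MaxRAB) \<and>
   (\<exists>p T. (\<lambda>n. real (T n)) \<in> O(\<lambda>n. real n ^ 3) \<and> solves_within p T MinRAB)"
proof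
  show "\<exists>p T. (\<lambda>n. real (T n)) \<in> O(\<lambda>n. real n ^ 3) \<and> solves_within p T MaxRAB"
    by (rule Extend_solves[of 0]) (simp, rule MaxRAB_I)
  show "\<exists>p T. (\<lambda>n. real (T n)) \<in> O(\<lambda>n. real n ^ 3) \<and> solves_within p T MinRAB"
    by (rule Extend_solves[of 1]) (simp, rule MinRAB_I)
qed

end
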